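(* Let $\Bbbk$ be a field and let $\mathcal{P}$ be a 2-unitary operad over $\Bbbk$ of Gelfand-Kirillov dimension two. Let $\overline{\mathcal{P}(1)}$ be the augmentation ideal of the associative algebra $\mathcal{P}(1)$. Then there is a short exact sequence of Lie algebras $$0\to \Bbbk\to \operatorname{der}(\mathcal{P})\to \operatorname{der}(\overline{\mathcal{P}(1)})\to 0.$$ As a consequence, $\operatorname{der}(\mathcal{P})\cong \Bbbk\rtimes\operatorname{der}(\overline{\mathcal{P}(1)})$ and $H^1(\mathcal{P})\cong \operatorname{HH}^1(\overline{\mathcal{P}(1)})$.
   Context: $\Bbbk$ is a field. An operad is a symmetric $\Bbbk$-linear operad $\mathcal{P}=(\mathcal{P}(n))_{n\ge 0}$: right $\Bbbk\mathbb{S}_n$-modules $\mathcal{P}(n)$, an identity $\mathbf{1}\in\mathcal{P}(1)$, and partial compositions $-\circ_i-:\mathcal{P}(m)\otimes\mathcal{P}(n)\to\mathcal{P}(m+n-1)$ satisfying the usual identity, associativity and equivariance axioms. $\mathcal{P}$ is unitary if $\mathcal{P}(0)=\Bbbk\mathbf{1}_0\cong\Bbbk$ for a fixed basis element $\mathbf{1}_0$; it is 2-unitary if moreover there is $\mathbf{1}_2\in\mathcal{P}(2)$ with $\mathbf{1}_2\circ_1\mathbf{1}_0=\mathbf{1}=\mathbf{1}_2\circ_2\mathbf{1}_0$. The Gelfand-Kirillov dimension is $\operatorname{GKdim}\mathcal{P}=\limsup_{n\to\infty}\log_n\big(\sum_{i=0}^n\dim_{\Bbbk}\mathcal{P}(i)\big)$.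 $\mathcal{P}(1)$ is a unital associative algebra with product $\circ_1$; for unitary $\mathcal{P}$ it is augmented by the algebra map $\mathcal{P}(1)\to\Bbbk$, $\theta\mapsto c$ where $\theta\circ_1\mathbf{1}_0=c\mathbf{1}_0$, and $\overline{\mathcal{P}(1)}$ is the kernel of this map, a (generally nonunital) associative algebra. A derivation of $\mathcal{P}$ is an arity-preserving $\Bbbk$-linear map $\partial:\mathcal{P}\to\mathcal{P}$, commuting with the $\mathbb{S}_n$-actions, with $\partial(\mu\circ_i\nu)=\partial(\mu)\circ_i\nu+\mu\circ_i\partial(\nu)$. $\operatorname{der}(\mathcal{P})$ is the Lie algebra of derivations. For $\lambda\in\mathcal{P}(1)$, $\operatorname{ad}_\lambda(\theta)=\lambda\circ_1\theta-\sum_{i=1}^n\theta\circ_i\lambda$ ($\theta\in\mathcal{P}(n)$) is an inner derivation; $\operatorname{ider}(\mathcal{P})$ is the set of these, and $H^1(\mathcal{P}):=\operatorname{der}(\mathcal{P})/\operatorname{ider}(\mathcal{P})$. For a possibly nonunital associative algebra $B$, $\operatorname{der}(B)$ is the Lie algebra of $\Bbbk$-linear derivations, $\operatorname{ider}(B)=\{[b,-]:b\in B\}$, and $\operatorname{HH}^1(B):=\operatorname{der}(B)/\operatorname{ider}(B)$. *)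

theory Defs
  imports "HOL-Analysis.Analysis"
begin

section \<open>Lie algebras on carrier sets\<close>

record ('k, 'v) lie_struct =
  lcarrier :: "'v set"
  lzero :: 'v
  ladd :: "'v \<Rightarrow> 'v \<Rightarrow> 'v"
  lsmult :: "'k \<Rightarrow> 'v \<Rightarrow> 'v"
  lbracket :: "'v \<Rightarrow> 'v \<Rightarrow> 'v"

locale lie_algebra =
  fixes L :: "('k::field, 'v) lie_struct"
  assumes zero_closed: "lzero L \<in> lcarrier L"
    and add_closed: "\<lbrakk>x \<in> lcarrier L; y \<in> lcarrier L\<rbrakk> \<Longrightarrow> ladd L x y \<in> lcarrier L"
    and smult_closed: "x \<in> lcarrier L \<Longrightarrow> lsmult L c x \<in> lcarrier L"
    and bracket_closed: "\<lbrakk>x \<in> lcarrier L; y \<in> lcarrier L\<rbrakk> \<Longrightarrow> lbracket L x y \<in> lcarrier L"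
    and add_assoc: "\<lbrakk>x \<in> lcarrier L; y \<in> lcarrier L; z \<in> lcarrier L\<rbrakk>
          \<Longrightarrow> ladd L (ladd L x y) z = ladd L x (ladd L y z)"
    and add_comm: "\<lbrakk>x \<in> lcarrier L; y \<in> lcarrier L\<rbrakk> \<Longrightarrow> ladd L x y = ladd L y x"
    and add_zero: "x \<in> lcarrier L \<Longrightarrow> ladd L x (lzero L) = x"
    and add_inverse: "x \<in> lcarrier L \<Longrightarrow> \<exists>y\<in>lcarrier L. ladd L x y = lzero L"
    and smult_one: "x \<in> lcarrier L \<Longrightarrow> lsmult L 1 x = x"
    and smult_mult: "x \<in> lcarrier L \<Longrightarrow> lsmult L (a * b) x = lsmult L a (lsmult L b x)"
    and smult_add_left: "x \<in> lcarrier L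
          \<Longrightarrow> lsmult L (a + b) x = ladd L (lsmult L a x) (lsmult L b x)"
    and smult_add_right: "\<lbrakk>x \<in> lcarrier L; y \<in> lcarrier L\<rbrakk>
          \<Longrightarrow> lsmult L a (ladd L x y) = ladd L (lsmult L a x) (lsmult L a y)"
    and bracket_add_left: "\<lbrakk>x \<in> lcarrier L; y \<in> lcarrier L; z \<in> lcarrier L\<rbrakk>
          \<Longrightarrow> lbracket L (ladd L x y) z = ladd L (lbracket L x z) (lbracket L y z)"
    and bracket_add_right: "\<lbrakk>x \<in> lcarrier L; y \<in> lcarrier L; z \<in> lcarrier L\<rbrakk>
          \<Longrightarrow> lbracket L x (ladd L y z) = ladd L (lbracket L x y) (lbracket L x z)"
    and bracket_smult_left: "\<lbrakk>x \<in> lcarrier L; y \<in> lcarrier L\<rbrakk>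
          \<Longrightarrow> lbracket L (lsmult L a x) y = lsmult L a (lbracket L x y)"
    and bracket_smult_right: "\<lbrakk>x \<in> lcarrier L; y \<in> lcarrier L\<rbrakk>
          \<Longrightarrow> lbracket L x (lsmult L a y) = lsmult L a (lbracket L x y)"
    and bracket_self: "x \<in> lcarrier L \<Longrightarrow> lbracket L x x = lzero L"
    and jacobi: "\<lbrakk>x \<in> lcarrier L; y \<in> lcarrier L; z \<in> lcarrier L\<rbrakk> \<Longrightarrow>
          ladd L (lbracket L x (lbracket L y z))
            (ladd L (lbracket L y (lbracket L z x)) (lbracket L z (lbracket L x y))) = lzero L"

locale lie_hom = dom: lie_algebra L + cod: lie_algebra M
  for L :: "('k::field, 'v) lie_struct" and M :: "('k, 'w) lie_struct" +
  fixes f :: "'v \<Rightarrow> 'w"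
  assumes hom_closed: "x \<in> lcarrier L \<Longrightarrow> f x \<in> lcarrier M"
    and hom_add: "\<lbrakk>x \<in> lcarrier L; y \<in> lcarrier L\<rbrakk> \<Longrightarrow> f (ladd L x y) = ladd M (f x) (f y)"
    and hom_smult: "x \<in> lcarrier L \<Longrightarrow> f (lsmult L c x) = lsmult M c (f x)"
    and hom_bracket: "\<lbrakk>x \<in> lcarrier L; y \<in> lcarrier L\<rbrakk>
          \<Longrightarrow> f (lbracket L x y) = lbracket M (f x) (f y)"

definition lie_isomorphic ::
    "('k::field, 'v) lie_struct \<Rightarrow> ('k, 'w) lie_struct \<Rightarrow> bool" where
  "lie_isomorphic L M \<longleftrightarrow> (\<exists>f. lie_hom L M f \<and> bij_betw f (lcarrier L) (lcarrier M))"

definition lie_short_exact ::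
    "('k::field, 'u) lie_struct \<Rightarrow> ('u \<Rightarrow> 'v) \<Rightarrow> ('k, 'v) lie_struct \<Rightarrow> ('v \<Rightarrow> 'w)
      \<Rightarrow> ('k, 'w) lie_struct \<Rightarrow> bool" where
  "lie_short_exact K f L g M \<longleftrightarrow>
     lie_hom K L f \<and> lie_hom L M g \<and>
     inj_on f (lcarrier K) \<and>
     f ` lcarrier K = {x \<in> lcarrier L. g x = lzero M} \<and>
     g ` lcarrier L = lcarrier M"

definition lie_line :: "('k::field, 'k) lie_struct" where
  "lie_line = \<lparr>lcarrier = UNIV, lzero = 0, ladd = (+), lsmult = (*), lbracket = (\<lambda>_ _. 0)\<rparr>"

definition lie_coset :: "('k, 'v) lie_struct \<Rightarrow> 'v set \<Rightarrow> 'v \<Rightarrow> 'v set" where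
  "lie_coset L I x = ladd L x ` I"

text \<open>Quotient by an ideal \<open>I\<close> (given by its carrier set). The unions run over all
  representatives; for an ideal \<open>I\<close> all the cosets in a union coincide.\<close>

definition lie_quot :: "('k, 'v) lie_struct \<Rightarrow> 'v set \<Rightarrow> ('k, 'v set) lie_struct" where
  "lie_quot L I =
     \<lparr>lcarrier = lie_coset L I ` lcarrier L,
      lzero = lie_coset L I (lzero L),
      ladd = (\<lambda>X Y. \<Union>x\<in>X. \<Union>y\<in>Y. lie_coset L I (ladd L x y)),
      lsmult = (\<lambda>c X. \<Union>x\<in>X. lie_coset L I (lsmult L c x)),
      lbracket = (\<lambda>X Y. \<Union>x\<in>X. \<Union>y\<in>Y. lie_coset L I (lbracket L x y))\<rparr>"

text \<open>An action of \<open>L\<close> on \<open>K\<close>, i.e. a Lie algebra homomorphism from \<open>L\<close> to the derivations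
  of the Lie algebra \<open>K\<close>.\<close>

definition lie_action ::
    "('k::field, 'w) lie_struct \<Rightarrow> ('k, 'v) lie_struct \<Rightarrow> ('w \<Rightarrow> 'v \<Rightarrow> 'v) \<Rightarrow> bool" where
  "lie_action L K \<phi> \<longleftrightarrow>
     lie_algebra L \<and> lie_algebra K \<and>
     (\<forall>x\<in>lcarrier L. \<forall>a\<in>lcarrier K. \<phi> x a \<in> lcarrier K) \<and>
     (\<forall>x\<in>lcarrier L. \<forall>a\<in>lcarrier K. \<forall>b\<in>lcarrier K.
        \<phi> x (ladd K a b) = ladd K (\<phi> x a) (\<phi> x b)) \<and>
     (\<forall>x\<in>lcarrier L. \<forall>a\<in>lcarrier K. \<forall>c. \<phi> x (lsmult K c a) = lsmult K c (\<phi> x a)) \<and>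
     (\<forall>x\<in>lcarrier L. \<forall>a\<in>lcarrier K. \<forall>b\<in>lcarrier K.
        \<phi> x (lbracket K a b) = ladd K (lbracket K (\<phi> x a) b) (lbracket K a (\<phi> x b))) \<and>
     (\<forall>x\<in>lcarrier L. \<forall>y\<in>lcarrier L. \<forall>a\<in>lcarrier K.
        \<phi> (ladd L x y) a = ladd K (\<phi> x a) (\<phi> y a)) \<and>
     (\<forall>x\<in>lcarrier L. \<forall>a\<in>lcarrier K. \<forall>c. \<phi> (lsmult L c x) a = lsmult K c (\<phi> x a)) \<and>
     (\<forall>x\<in>lcarrier L. \<forall>y\<in>lcarrier L. \<forall>a\<in>lcarrier K.
        \<phi> (lbracket L x y) a = ladd K (\<phi> x (\<phi> y a)) (lsmult K (-1) (\<phi> y (\<phi> x a))))"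

text \<open>The semidirect product of \<open>K\<close> and \<open>L\<close>, with \<open>K\<close> the ideal.\<close>

definition lie_semidirect ::
    "('k::field, 'v) lie_struct \<Rightarrow> ('w \<Rightarrow> 'v \<Rightarrow> 'v) \<Rightarrow> ('k, 'w) lie_struct
      \<Rightarrow> ('k, 'v \<times> 'w) lie_struct" where
  "lie_semidirect K \<phi> L =
     \<lparr>lcarrier = lcarrier K \<times> lcarrier L,
      lzero = (lzero K, lzero L),
      ladd = (\<lambda>(a, x) (b, y). (ladd K a b, ladd L x y)),
      lsmult = (\<lambda>c (a, x). (lsmult K c a, lsmult L c x)),
      lbracket = (\<lambda>(a, x) (b, y).
        (ladd K (lbracket K a b) (ladd K (\<phi> x b) (lsmult K (-1) (\<phi> y a))),
         lbracket L x y))\<rparr>"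

section \<open>Possibly nonunital associative algebras and their derivations\<close>

text \<open>The underlying vector space is a subspace of an ambient vector space, whose addition is
  that of the type \<open>'a\<close>.\<close>

record ('k, 'a) nu_algebra =
  alg_scale :: "'k \<Rightarrow> 'a \<Rightarrow> 'a"
  alg_carrier :: "'a set"
  alg_mult :: "'a \<Rightarrow> 'a \<Rightarrow> 'a"

definition linear_between :: "('k \<Rightarrow> 'a \<Rightarrow> 'a::ab_group_add) \<Rightarrow> 'a set \<Rightarrow> 'a set \<Rightarrow> ('a \<Rightarrow> 'a) \<Rightarrow> bool" where
  "linear_between s V W f \<longleftrightarrow>
     (\<forall>x\<in>V. f x \<in> W) \<and>
     (\<forall>x\<in>V. \<forall>y\<in>V. f (x + y) = f x + f y) \<and>
     (\<forall>x\<in>V. \<forall>c. f (s c x) = s c (f x))"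

text \<open>Maps defined on a subspace are represented by functions that vanish outside it, so that
  equality of such functions is equality of maps; this normalization is stable under the pointwise
  operations and under commutators.\<close>

definition alg_derivation :: "('k, 'a::ab_group_add) nu_algebra \<Rightarrow> ('a \<Rightarrow> 'a) \<Rightarrow> bool" where
  "alg_derivation B d \<longleftrightarrow>
     linear_between (alg_scale B) (alg_carrier B) (alg_carrier B) d \<and>
     (\<forall>x\<in>alg_carrier B. \<forall>y\<in>alg_carrier B.
        d (alg_mult B x y) = alg_mult B (d x) y + alg_mult B x (d y)) \<and>
     (\<forall>x. x \<notin> alg_carrier B \<longrightarrow> d x = 0)"

definition alg_der :: "('k, 'a::ab_group_add) nu_algebra \<Rightarrow> ('k, 'a \<Rightarrow> 'a) lie_struct" where
  "alg_der B =
     \<lparr>lcarrier = {d. alg_derivation B d},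
      lzero = (\<lambda>x. 0),
      ladd = (\<lambda>d e x. d x + e x),
      lsmult = (\<lambda>c d x. alg_scale B c (d x)),
      lbracket = (\<lambda>d e x. d (e x) - e (d x))\<rparr>"

definition alg_ad :: "('k, 'a::ab_group_add) nu_algebra \<Rightarrow> 'a \<Rightarrow> 'a \<Rightarrow> 'a" where
  "alg_ad B b = (\<lambda>x. if x \<in> alg_carrier B then alg_mult B b x - alg_mult B x b else 0)"

definition alg_ider :: "('k, 'a::ab_group_add) nu_algebra \<Rightarrow> ('a \<Rightarrow> 'a) set" where
  "alg_ider B = alg_ad B ` alg_carrier B"

definition HH1 :: "('k, 'a::ab_group_add) nu_algebra \<Rightarrow> ('k, ('a \<Rightarrow> 'a) set) lie_struct" where
  "HH1 B = lie_quot (alg_der B) (alg_ider B)"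

section \<open>Symmetric linear operads\<close>

text \<open>The vector spaces \<open>arity P n\<close> are subspaces of one ambient vector space (every family of
  vector spaces embeds into its direct sum). They need not be independent or disjoint: all
  operations are indexed by the arities of their arguments. \<open>pcomp P m n i \<mu> \<nu>\<close> is the partial
  composition of \<open>\<mu>\<close> of arity \<open>m\<close> and \<open>\<nu>\<close> of arity \<open>n\<close> at the input \<open>i \<in> {1..m}\<close>, and
  \<open>pact P n \<mu> \<sigma>\<close> is the right action of \<open>\<sigma>\<close> on \<open>\<mu>\<close> of arity \<open>n\<close>.\<close>

record ('k, 'a) operad_data =
  scal :: "'k \<Rightarrow> 'a \<Rightarrow> 'a"
  arity :: "nat \<Rightarrow> 'a set"
  pact :: "nat \<Rightarrow> 'a \<Rightarrow> (nat \<Rightarrow> nat) \<Rightarrow> 'a"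
  pcomp :: "nat \<Rightarrow> nat \<Rightarrow> nat \<Rightarrow> 'a \<Rightarrow> 'a \<Rightarrow> 'a"
  pone :: 'a

text \<open>The permutation of \<open>{1..m+n-1}\<close> obtained from \<open>\<sigma>\<close>, a permutation of \<open>{1..m}\<close>, by
  replacing the input \<open>i\<close> with a block of \<open>n\<close> inputs that are permuted by \<open>\<tau>\<close>. As in the
  endomorphism operad, where \<open>(f\<cdot>\<sigma>)(x\<^sub>1,\<dots>,x\<^sub>m)\<close> is \<open>f\<close> with \<open>x\<^sub>j\<close> inserted in slot \<open>\<sigma> j\<close>, the
  block lands in the slots starting at \<open>\<sigma> i\<close>.\<close>

definition perm_comp :: "nat \<Rightarrow> nat \<Rightarrow> nat \<Rightarrow> (nat \<Rightarrow> nat) \<Rightarrow> (nat \<Rightarrow> nat) \<Rightarrow> nat \<Rightarrow> nat" where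
  "perm_comp m n i \<sigma> \<tau> p =
     (let shift = (\<lambda>q. if q < \<sigma> i then q else q + n - 1) in
      if p < 1 \<or> m + n - 1 < p then p
      else if p < i then shift (\<sigma> p)
      else if p < i + n then \<sigma> i + \<tau> (p + 1 - i) - 1
      else shift (\<sigma> (p + 1 - n)))"

locale operad =
  fixes P :: "('k::field, 'a::ab_group_add) operad_data"
  assumes vector_space: "vector_space (scal P)"
    and arity_subspace: "module.subspace (scal P) (arity P n)"
    and act_linear: "\<sigma> permutes {1..n} \<Longrightarrow>
          linear_between (scal P) (arity P n) (arity P n) (\<lambda>\<mu>. pact P n \<mu> \<sigma>)"
    and act_id: "\<mu> \<in> arity P n \<Longrightarrow> pact P n \<mu> id = \<mu>"
    and act_act: "\<lbrakk>\<mu> \<in> arity P n; \<sigma> permutes {1..n}; \<tau> permutes {1..n}\<rbrakk>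
          \<Longrightarrow> pact P n (pact P n \<mu> \<sigma>) \<tau> = pact P n \<mu> (\<sigma> \<circ> \<tau>)"
    and one_closed: "pone P \<in> arity P 1"
    and comp_linear_left: "\<lbrakk>i \<in> {1..m}; \<nu> \<in> arity P n\<rbrakk> \<Longrightarrow>
          linear_between (scal P) (arity P m) (arity P (m + n - 1)) (\<lambda>\<mu>. pcomp P m n i \<mu> \<nu>)"
    and comp_linear_right: "\<lbrakk>i \<in> {1..m}; \<mu> \<in> arity P m\<rbrakk> \<Longrightarrow>
          linear_between (scal P) (arity P n) (arity P (m + n - 1)) (\<lambda>\<nu>. pcomp P m n i \<mu> \<nu>)"
    and one_comp: "\<nu> \<in> arity P n \<Longrightarrow> pcomp P 1 n 1 (pone P) \<nu> = \<nu>"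
    and comp_one: "\<lbrakk>\<mu> \<in> arity P m; i \<in> {1..m}\<rbrakk> \<Longrightarrow> pcomp P m 1 i \<mu> (pone P) = \<mu>"
    and comp_sequential:
      "\<lbrakk>\<mu> \<in> arity P l; \<nu> \<in> arity P m; \<xi> \<in> arity P n; i \<in> {1..l}; j \<in> {1..m}\<rbrakk> \<Longrightarrow>
         pcomp P (l + m - 1) n (i - 1 + j) (pcomp P l m i \<mu> \<nu>) \<xi> =
         pcomp P l (m + n - 1) i \<mu> (pcomp P m n j \<nu> \<xi>)"
    and comp_parallel:
      "\<lbrakk>\<mu> \<in> arity P l; \<nu> \<in> arity P m; \<xi> \<in> arity P n; 1 \<le> i; i < k; k \<le> l\<rbrakk> \<Longrightarrow>
         pcomp P (l + m - 1) n (k - 1 + m) (pcomp P l m i \<mu> \<nu>) \<xi> =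
         pcomp P (l + n - 1) m i (pcomp P l n k \<mu> \<xi>) \<nu>"
    and comp_equivariant:
      "\<lbrakk>\<mu> \<in> arity P m; \<nu> \<in> arity P n; i \<in> {1..m}; \<sigma> permutes {1..m}; \<tau> permutes {1..n}\<rbrakk> \<Longrightarrow>
         pcomp P m n i (pact P m \<mu> \<sigma>) (pact P n \<nu> \<tau>) =
         pact P (m + n - 1) (pcomp P m n (\<sigma> i) \<mu> \<nu>) (perm_comp m n i \<sigma> \<tau>)"

locale unitary_operad = operad P
  for P :: "('k::field, 'a::ab_group_add) operad_data" +
  fixes u0 :: 'a
  assumes u0_nonzero: "u0 \<noteq> 0"
    and arity_0: "arity P 0 = range (\<lambda>c. scal P c u0)"

locale two_unitary_operad = unitary_operad P u0
  for P :: "('k::field, 'a::ab_group_add) operad_data" and u0 :: 'a +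
  assumes ex_u2: "\<exists>u2\<in>arity P 2. pcomp P 2 0 1 u2 u0 = pone P \<and> pcomp P 2 0 2 u2 u0 = pone P"

text \<open>\<open>vector_space.dim\<close> is \<open>0\<close> on spaces of infinite dimension, so these are treated
  separately and contribute the value \<open>\<infinity>\<close>.\<close>

definition finite_dim_subspace :: "('k::field \<Rightarrow> 'a \<Rightarrow> 'a::ab_group_add) \<Rightarrow> 'a set \<Rightarrow> bool" where
  "finite_dim_subspace s V \<longleftrightarrow> (\<exists>B. finite B \<and> module.span s B = V)"

definition GKdim :: "('k::field, 'a::ab_group_add) operad_data \<Rightarrow> ereal" where
  "GKdim P = limsup (\<lambda>n::nat.
     if \<forall>i\<le>n. finite_dim_subspace (scal P) (arity P i)
     then ereal (log (real n) (real (\<Sum>i\<le>n. vector_space.dim (scal P) (arity P i))))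
     else \<infinity>)"

definition augmentation :: "('k, 'a) operad_data \<Rightarrow> 'a \<Rightarrow> 'a \<Rightarrow> 'k" where
  "augmentation P u0 \<theta> = (THE c. pcomp P 1 0 1 \<theta> u0 = scal P c u0)"

definition aug_ideal :: "('k::zero, 'a) operad_data \<Rightarrow> 'a \<Rightarrow> ('k, 'a) nu_algebra" where
  "aug_ideal P u0 =
     \<lparr>alg_scale = scal P,
      alg_carrier = {\<theta> \<in> arity P 1. augmentation P u0 \<theta> = 0},
      alg_mult = pcomp P 1 1 1\<rparr>"

definition operad_derivation ::
    "('k, 'a::ab_group_add) operad_data \<Rightarrow> (nat \<Rightarrow> 'a \<Rightarrow> 'a) \<Rightarrow> bool" where
  "operad_derivation P d \<longleftrightarrow>
     (\<forall>n. linear_between (scal P) (arity P n) (arity P n) (d n)) \<and>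
     (\<forall>n \<sigma>. \<forall>\<mu>\<in>arity P n. \<sigma> permutes {1..n} \<longrightarrow> d n (pact P n \<mu> \<sigma>) = pact P n (d n \<mu>) \<sigma>) \<and>
     (\<forall>m n. \<forall>i\<in>{1..m}. \<forall>\<mu>\<in>arity P m. \<forall>\<nu>\<in>arity P n.
        d (m + n - 1) (pcomp P m n i \<mu> \<nu>) = pcomp P m n i (d m \<mu>) \<nu> + pcomp P m n i \<mu> (d n \<nu>)) \<and>
     (\<forall>n x. x \<notin> arity P n \<longrightarrow> d n x = 0)"

definition operad_der ::
    "('k, 'a::ab_group_add) operad_data \<Rightarrow> ('k, nat \<Rightarrow> 'a \<Rightarrow> 'a) lie_struct" where
  "operad_der P =
     \<lparr>lcarrier = {d. operad_derivation P d},
      lzero = (\<lambda>n x. 0),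
      ladd = (\<lambda>d e n x. d n x + e n x),
      lsmult = (\<lambda>c d n x. scal P c (d n x)),
      lbracket = (\<lambda>d e n x. d n (e n x) - e n (d n x))\<rparr>"

definition operad_ad :: "('k, 'a::ab_group_add) operad_data \<Rightarrow> 'a \<Rightarrow> nat \<Rightarrow> 'a \<Rightarrow> 'a" where
  "operad_ad P u = (\<lambda>n \<theta>. if \<theta> \<in> arity P n
     then pcomp P 1 n 1 u \<theta> - (\<Sum>i = 1..n. pcomp P n 1 i \<theta> u) else 0)"

definition operad_ider :: "('k, 'a::ab_group_add) operad_data \<Rightarrow> (nat \<Rightarrow> 'a \<Rightarrow> 'a) set" where
  "operad_ider P = operad_ad P ` arity P 1"

definition operad_H1 ::
    "('k, 'a::ab_group_add) operad_data \<Rightarrow> ('k, (nat \<Rightarrow> 'a \<Rightarrow> 'a) set) lie_struct" where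
  "operad_H1 P = lie_quot (operad_der P) (operad_ider P)"

end

theory Submission
  imports Defs "HOL-Real_Asymp.Real_Asymp"
begin

text \<open>
  Let \<open>A\<close> be the augmentation ideal of \<open>P(1)\<close>. The operations that \<open>P\<close> provides are plugging inputs
  with the nullary operation \<open>u0\<close> (\<open>kill\<close>), and adding inputs by means of the product \<open>u2\<close>, for which
  \<open>u0\<close> is a unit.

  The growth hypothesis enters once, in \<open>kill_jointly_injective\<close>: if a nonzero operation of some
  arity \<open>m \<ge> 2\<close> died under plugging any of its inputs, adding dummy inputs to it would produce
  quadratically many independent operations in each arity, so the Gelfand-Kirillov dimension would be
  at least three. Plugging all inputs but one therefore embeds \<open>P(n)\<close>, for \<open>n \<ge> 1\<close>, into \<open>P(1)\<^sup>n\<close>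
  (\<open>coordinates_injective\<close>). All coordinates of an operation have the same augmentation, and
  conversely any vector with entries in \<open>A\<close> occurs (\<open>res_insert_aug\<close>). Composition and symmetric
  group action are explicit in these coordinates (\<open>res_comp_inside\<close>, \<open>res_comp_left\<close>,
  \<open>res_comp_right\<close>, \<open>res_act\<close>).

  A derivation \<open>D\<close> scales \<open>u0\<close> by some scalar \<open>c\<close>, its weight, and restricts to a derivation \<open>d\<close> of \<open>A\<close>.
  In coordinates \<open>D\<close> acts on \<open>P(n)\<close> as \<open>d\<close> on every entry plus multiplication by \<open>c (1 - n)\<close>
  (\<open>res_derivation\<close>), and every pair \<open>(c, d)\<close> occurs (\<open>operad_derivation_extend\<close>). Commutators have
  weight zero, so \<open>D \<mapsto> (c, d)\<close> is an isomorphism of Lie algebras onto the direct product of the line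
  and the derivations of \<open>A\<close>; this gives the exact sequence and the semidirect product, with the
  zero action. The inner derivation of \<open>u = c 1 + a\<close> with \<open>a \<in> A\<close> corresponds to \<open>(c, [a, -])\<close>
  (\<open>operad_ad_eq_extend\<close>). Inner derivations therefore form the full preimage of the inner
  derivations of \<open>A\<close>, and the first cohomology Lie algebras agree.
\<close>

section \<open>Linear maps between subspaces\<close>

lemma linear_between_diff:
  assumes "vector_space s" "module.subspace s V" "linear_between s V W f" "x \<in> V" "y \<in> V"
  shows "f (x - y) = f x - f y"
proof -
  interpret vector_space s by fact
  have "x - y \<in> V" using assms subspace_diff by blast
  then have "f ((x - y) + y) = f (x - y) + f y"
    using assms(3,5) unfolding linear_between_def by blast
  then show ?thesis by simp
qed

lemma linear_between_zero:
  assumes "vector_space s" "module.subspace s V" "linear_between s V W f"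
  shows "f 0 = 0"
proof -
  interpret vector_space s by fact
  have "0 \<in> V" using assms(2) subspace_0 by blast
  then show ?thesis using linear_between_diff[OF assms, of 0 0] by simp
qed

lemma linear_between_sum:
  assumes "vector_space s" "module.subspace s V" "linear_between s V W f"
    and "\<And>i. i \<in> A \<Longrightarrow> v i \<in> V"
  shows "f (\<Sum>i\<in>A. v i) = (\<Sum>i\<in>A. f (v i))"
proof -
  interpret vector_space s by fact
  show ?thesis using assms(4)
  proof (induction A rule: infinite_finite_induct)
    case (insert x F)
    have "(\<Sum>i\<in>F. v i) \<in> V" using insert.prems by (intro subspace_sum[OF assms(2)]) simp
    then have "f (v x + (\<Sum>i\<in>F. v i)) = f (v x) + f (\<Sum>i\<in>F. v i)"
      using assms(3) insert.prems unfolding linear_between_def by blast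
    then show ?case using insert by simp
  qed (use linear_between_zero[OF assms(1-3)] in auto)
qed

section \<open>Constructing Lie algebras\<close>

text \<open>Apart from the existence of negatives the axioms are equations, and both kinds of axiom pass
  from a Lie algebra to any structure onto which it is mapped compatibly with the operations. This
  settles quotients and semidirect products without checking their axioms one by one.\<close>

lemma lie_algebra_surjective_image:
  fixes L :: "('k::field, 'v) lie_struct" and M :: "('k, 'w) lie_struct"
  assumes L: "lie_algebra L"
    and carrier: "lcarrier M = f ` lcarrier L"
    and zero: "f (lzero L) = lzero M"
    and add: "\<And>x y. \<lbrakk>x \<in> lcarrier L; y \<in> lcarrier L\<rbrakk> \<Longrightarrow> f (ladd L x y) = ladd M (f x) (f y)"
    and smult: "\<And>c x. x \<in> lcarrier L \<Longrightarrow> f (lsmult L c x) = lsmult M c (f x)"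
    and bracket: "\<And>x y. \<lbrakk>x \<in> lcarrier L; y \<in> lcarrier L\<rbrakk>
          \<Longrightarrow> f (lbracket L x y) = lbracket M (f x) (f y)"
  shows "lie_algebra M"
proof -
  interpret L: lie_algebra L by (rule L)
  note closed = L.zero_closed L.add_closed L.smult_closed L.bracket_closed
  note hom = zero[symmetric] add[symmetric] smult[symmetric] bracket[symmetric]
  have comm: "ladd M x y = ladd M y x" if xy: "x \<in> f ` lcarrier L" "y \<in> f ` lcarrier L" for x y
  proof -
    obtain a b where "a \<in> lcarrier L" "b \<in> lcarrier L" "x = f a" "y = f b" using xy by blast
    then show ?thesis by (metis L.add_comm add)
  qed
  have inverse: "\<exists>y\<in>f ` lcarrier L. ladd M x y = lzero M" if x: "x \<in> f ` lcarrier L" for x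
  proof -
    obtain a where a: "a \<in> lcarrier L" "x = f a" using x by blast
    obtain b where b: "b \<in> lcarrier L" "ladd L a b = lzero L" using L.add_inverse[OF a(1)] by blast
    have "ladd M x (f b) = lzero M" using a b by (simp add: hom)
    then show ?thesis using b(1) by blast
  qed
  have jacobi: "ladd M (lbracket M x (lbracket M y z))
      (ladd M (lbracket M y (lbracket M z x)) (lbracket M z (lbracket M x y))) = lzero M"
    if xyz: "x \<in> f ` lcarrier L" "y \<in> f ` lcarrier L" "z \<in> f ` lcarrier L" for x y z
  proof -
    obtain a b c where abc: "a \<in> lcarrier L" "b \<in> lcarrier L" "c \<in> lcarrier L"
      and "x = f a" "y = f b" "z = f c" using xyz by blast
    then show ?thesis using L.jacobi[OF abc] by (simp add: hom closed)
  qed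
  show ?thesis
    by (unfold_locales; unfold carrier; (fact comm inverse jacobi)?; (elim imageE)?;
        simp add: imageI hom closed L.add_assoc L.add_zero L.smult_one L.smult_mult
          L.smult_add_left L.smult_add_right L.bracket_add_left L.bracket_add_right
          L.bracket_smult_left L.bracket_smult_right L.bracket_self)
qed

lemma lie_hom_surjective:
  fixes L :: "('k::field, 'v) lie_struct" and M :: "('k, 'w) lie_struct"
  assumes L: "lie_algebra L"
    and carrier: "lcarrier M = f ` lcarrier L"
    and zero: "f (lzero L) = lzero M"
    and add: "\<And>x y. \<lbrakk>x \<in> lcarrier L; y \<in> lcarrier L\<rbrakk> \<Longrightarrow> f (ladd L x y) = ladd M (f x) (f y)"
    and smult: "\<And>c x. x \<in> lcarrier L \<Longrightarrow> f (lsmult L c x) = lsmult M c (f x)"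
    and bracket: "\<And>x y. \<lbrakk>x \<in> lcarrier L; y \<in> lcarrier L\<rbrakk>
          \<Longrightarrow> f (lbracket L x y) = lbracket M (f x) (f y)"
  shows "lie_hom L M f"
proof -
  have M: "lie_algebra M"
    using assms by (rule lie_algebra_surjective_image)
  show ?thesis
    by (intro lie_hom.intro lie_hom_axioms.intro L M) (simp_all add: carrier add smult bracket)
qed

lemma lie_algebra_line: "lie_algebra (lie_line :: ('k::field, 'k) lie_struct)"
proof unfold_locales
  fix x :: 'k
  show "\<exists>y\<in>lcarrier lie_line. ladd lie_line x y = lzero lie_line"
    by (rule bexI[of _ "- x"]) (simp_all add: lie_line_def)
qed (simp_all add: lie_line_def algebra_simps)

text \<open>For linear operators with the commutator bracket the Lie axioms, Jacobi included, are formal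
  consequences of linearity, so only closure under the operations has to be checked. The map \<open>ev\<close>
  realises an element of \<open>L\<close> as a family of operators; a single index gives algebra
  derivations, and arities as indices give operad derivations.\<close>

lemma lie_algebra_of_operators:
  fixes L :: "('k::field, 'v) lie_struct" and s :: "'k \<Rightarrow> 'a \<Rightarrow> 'a::ab_group_add"
    and V :: "'i \<Rightarrow> 'a set" and ev :: "'v \<Rightarrow> 'i \<Rightarrow> 'a \<Rightarrow> 'a"
  assumes s: "vector_space s"
    and V: "\<And>i. module.subspace s (V i)"
    and lin: "\<And>x i. x \<in> lcarrier L \<Longrightarrow> linear_between s (V i) (V i) (ev x i)"
    and ext: "\<And>x y. \<lbrakk>x \<in> lcarrier L; y \<in> lcarrier L; \<And>i a. a \<in> V i \<Longrightarrow> ev x i a = ev y i a\<rbrakk>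
          \<Longrightarrow> x = y"
    and zero: "lzero L \<in> lcarrier L" "\<And>i a. a \<in> V i \<Longrightarrow> ev (lzero L) i a = 0"
    and add: "\<And>x y. \<lbrakk>x \<in> lcarrier L; y \<in> lcarrier L\<rbrakk> \<Longrightarrow> ladd L x y \<in> lcarrier L"
      "\<And>x y i a. \<lbrakk>x \<in> lcarrier L; y \<in> lcarrier L; a \<in> V i\<rbrakk> \<Longrightarrow>
          ev (ladd L x y) i a = ev x i a + ev y i a"
    and smult: "\<And>c x. x \<in> lcarrier L \<Longrightarrow> lsmult L c x \<in> lcarrier L"
      "\<And>c x i a. \<lbrakk>x \<in> lcarrier L; a \<in> V i\<rbrakk> \<Longrightarrow> ev (lsmult L c x) i a = s c (ev x i a)"
    and bracket: "\<And>x y. \<lbrakk>x \<in> lcarrier L; y \<in> lcarrier L\<rbrakk> \<Longrightarrow> lbracket L x y \<in> lcarrier L"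
      "\<And>x y i a. \<lbrakk>x \<in> lcarrier L; y \<in> lcarrier L; a \<in> V i\<rbrakk> \<Longrightarrow>
          ev (lbracket L x y) i a = ev x i (ev y i a) - ev y i (ev x i a)"
  shows "lie_algebra L"
proof -
  interpret vector_space s by (rule s)
  have closed: "ev x i a \<in> V i" if "x \<in> lcarrier L" "a \<in> V i" for x i a
    using lin[OF that(1)] that(2) unfolding linear_between_def by blast
  have ev_add: "ev x i (a + b) = ev x i a + ev x i b"
    if "x \<in> lcarrier L" "a \<in> V i" "b \<in> V i" for x i a b
    using lin[OF that(1)] that(2,3) unfolding linear_between_def by blast
  have ev_scale: "ev x i (s c a) = s c (ev x i a)"
    if "x \<in> lcarrier L" "a \<in> V i" for x i a c
    using lin[OF that(1)] that(2) unfolding linear_between_def by blast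
  have ev_diff: "ev x i (a - b) = ev x i a - ev x i b"
    if "x \<in> lcarrier L" "a \<in> V i" "b \<in> V i" for x i a b
    using linear_between_diff[OF s V lin[OF that(1)]] that(2,3) by blast
  note [simp] = zero add smult bracket closed ev_add ev_scale ev_diff
    subspace_add[OF V] subspace_diff[OF V] subspace_scale[OF V]
  show ?thesis
  proof unfold_locales
    fix x assume x: "x \<in> lcarrier L"
    show "\<exists>y\<in>lcarrier L. ladd L x y = lzero L"
    proof (rule bexI)
      show "ladd L x (lsmult L (-1) x) = lzero L"
        using x by (intro ext) simp_all
    qed (use x in simp)
  qed ((intro ext)?; simp add: algebra_simps)+
qed

section \<open>Quotients of Lie algebras\<close>

definition lie_ideal :: "('k::field, 'v) lie_struct \<Rightarrow> 'v set \<Rightarrow> bool" where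
  "lie_ideal L I \<longleftrightarrow> I \<subseteq> lcarrier L \<and> lzero L \<in> I \<and>
     (\<forall>x\<in>I. \<forall>y\<in>I. ladd L x y \<in> I) \<and> (\<forall>x\<in>I. \<forall>c. lsmult L c x \<in> I) \<and>
     (\<forall>x\<in>lcarrier L. \<forall>y\<in>I. lbracket L x y \<in> I)"

context lie_algebra
begin

abbreviation neg where "neg x \<equiv> lsmult L (-1) x"

lemma smult_0: "x \<in> lcarrier L \<Longrightarrow> lsmult L 0 x = lzero L"
proof -
  assume x: "x \<in> lcarrier L"
  let ?z = "lsmult L 0 x"
  have z: "?z \<in> lcarrier L" using x by (rule smult_closed)
  have "ladd L ?z ?z = ?z" using smult_add_left[OF x, of 0 0] by simp
  moreover obtain y where y: "y \<in> lcarrier L" "ladd L ?z y = lzero L" using add_inverse[OF z] by blast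
  ultimately have "ladd L ?z (lzero L) = lzero L" using add_assoc[OF z z y(1)] by simp
  then show ?thesis using add_zero[OF z] by simp
qed

lemma add_neg: "x \<in> lcarrier L \<Longrightarrow> ladd L x (neg x) = lzero L"
  using smult_add_left[of x 1 "-1"] by (simp add: smult_one smult_0)

lemma add_neg_cancel:
  "\<lbrakk>x \<in> lcarrier L; y \<in> lcarrier L\<rbrakk> \<Longrightarrow> ladd L x (ladd L (neg x) y) = y"
  by (metis add_assoc add_comm add_neg add_zero smult_closed zero_closed)

lemma add_left_comm:
  "\<lbrakk>x \<in> lcarrier L; y \<in> lcarrier L; z \<in> lcarrier L\<rbrakk>
    \<Longrightarrow> ladd L x (ladd L y z) = ladd L y (ladd L x z)"
  by (metis add_assoc add_comm)

lemma coset_eq: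
  assumes I: "lie_ideal L I" and x: "x \<in> lcarrier L" and y: "y \<in> lie_coset L I x"
  shows "lie_coset L I y = lie_coset L I x"
proof -
  obtain i where i: "i \<in> I" "y = ladd L x i" using y unfolding lie_coset_def by blast
  have sub: "j \<in> lcarrier L" if "j \<in> I" for j using I that unfolding lie_ideal_def by blast
  have add: "ladd L j k \<in> I" if "j \<in> I" "k \<in> I" for j k using I that unfolding lie_ideal_def by blast
  have neg: "neg j \<in> I" if "j \<in> I" for j using I that unfolding lie_ideal_def by blast
  show ?thesis
  proof (intro set_eqI iffI)
    fix z assume "z \<in> lie_coset L I y"
    then obtain j where "j \<in> I" "z = ladd L y j" unfolding lie_coset_def by blast
    then have "z = ladd L x (ladd L i j)" using i x sub add_assoc by simp
    then show "z \<in> lie_coset L I x" using add[OF i(1) \<open>j \<in> I\<close>] unfolding lie_coset_def by blast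
  next
    fix z assume "z \<in> lie_coset L I x"
    then obtain j where j: "j \<in> I" "z = ladd L x j" unfolding lie_coset_def by blast
    have "z = ladd L x (ladd L i (ladd L (neg i) j))"
      using add_neg_cancel i j sub by simp
    also have "\<dots> = ladd L y (ladd L (neg i) j)"
      using add_assoc[OF x sub[OF i(1)], of "ladd L (neg i) j"] i(2) add[OF neg[OF i(1)] j(1)] sub
      by simp
    finally show "z \<in> lie_coset L I y"
      using add[OF neg[OF i(1)] j(1)] unfolding lie_coset_def by blast
  qed
qed

lemma coset_self: "\<lbrakk>lie_ideal L I; x \<in> lcarrier L\<rbrakk> \<Longrightarrow> x \<in> lie_coset L I x"
  unfolding lie_coset_def lie_ideal_def using add_zero by force

lemma coset_closed:
  "\<lbrakk>lie_ideal L I; x \<in> lcarrier L; y \<in> lie_coset L I x\<rbrakk> \<Longrightarrow> y \<in> lcarrier L"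
  unfolding lie_coset_def lie_ideal_def using add_closed by blast

text \<open>The operations of \<open>lie_quot\<close> are unions over all representatives. Such a union collapses to
  one coset as soon as changing the representative by \<open>I\<close> changes the value by \<open>I\<close>.\<close>

lemma coset_union:
  assumes I: "lie_ideal L I" and x: "x \<in> lcarrier L" and gx: "g x \<in> lcarrier L"
    and g: "\<And>i. i \<in> I \<Longrightarrow> \<exists>j\<in>I. g (ladd L x i) = ladd L (g x) j"
  shows "(\<Union>y\<in>lie_coset L I x. lie_coset L I (g y)) = lie_coset L I (g x)"
proof -
  have "lie_coset L I (g y) = lie_coset L I (g x)" if y: "y \<in> lie_coset L I x" for y
  proof (rule coset_eq[OF I gx])
    show "g y \<in> lie_coset L I (g x)" using y g unfolding lie_coset_def by force
  qed
  moreover have "lie_coset L I x \<noteq> {}" using coset_self[OF I x] by blast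
  ultimately show ?thesis by (intro SUP_eq_const)
qed

lemma quot_add:
  assumes I: "lie_ideal L I" and x: "x \<in> lcarrier L" and y: "y \<in> lcarrier L"
  shows "ladd (lie_quot L I) (lie_coset L I x) (lie_coset L I y) = lie_coset L I (ladd L x y)"
proof -
  have sub: "j \<in> lcarrier L" if "j \<in> I" for j using I that unfolding lie_ideal_def by blast
  have inner: "(\<Union>b\<in>lie_coset L I y. lie_coset L I (ladd L a b)) = lie_coset L I (ladd L a y)"
    if a: "a \<in> lcarrier L" for a
    using a y sub by (intro coset_union[OF I y]) (auto simp: add_closed add_assoc)
  have "(\<Union>a\<in>lie_coset L I x. \<Union>b\<in>lie_coset L I y. lie_coset L I (ladd L a b))
      = (\<Union>a\<in>lie_coset L I x. lie_coset L I (ladd L a y))"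
    using inner coset_closed[OF I x] by (intro SUP_cong) auto
  also have "\<dots> = lie_coset L I (ladd L x y)"
  proof (rule coset_union[OF I x])
    show "\<exists>j\<in>I. ladd L (ladd L x i) y = ladd L (ladd L x y) j" if "i \<in> I" for i
      using that x y sub by (intro bexI[of _ i]) (simp_all add: add_assoc add_comm[of i y])
  qed (use x y in \<open>simp add: add_closed\<close>)
  finally show ?thesis by (simp add: lie_quot_def)
qed

lemma quot_smult:
  assumes I: "lie_ideal L I" and x: "x \<in> lcarrier L"
  shows "lsmult (lie_quot L I) c (lie_coset L I x) = lie_coset L I (lsmult L c x)"
proof -
  have "(\<Union>a\<in>lie_coset L I x. lie_coset L I (lsmult L c a)) = lie_coset L I (lsmult L c x)"
  proof (rule coset_union[OF I x])
    show "\<exists>j\<in>I. lsmult L c (ladd L x i) = ladd L (lsmult L c x) j" if "i \<in> I" for i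
      using that x I unfolding lie_ideal_def
      by (intro bexI[of _ "lsmult L c i"]) (auto intro: smult_add_right)
  qed (use x in \<open>simp add: smult_closed\<close>)
  then show ?thesis by (simp add: lie_quot_def)
qed

lemma bracket_anticomm:
  assumes x: "x \<in> lcarrier L" and y: "y \<in> lcarrier L"
  shows "lbracket L x y = neg (lbracket L y x)"
proof -
  have xy: "ladd L x y \<in> lcarrier L" using x y by (rule add_closed)
  have "lzero L = lbracket L (ladd L x y) (ladd L x y)"
    using bracket_self[OF xy] by simp
  also have "\<dots> = ladd L (ladd L (lbracket L x x) (lbracket L x y))
      (ladd L (lbracket L y x) (lbracket L y y))"
    by (simp only: bracket_add_left[OF x y xy] bracket_add_right[OF x x y] bracket_add_right[OF y x y])
  also have "\<dots> = ladd L (lbracket L y x) (lbracket L x y)"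
    using x y by (metis add_comm add_zero bracket_closed bracket_self zero_closed)
  finally have "ladd L (lbracket L y x) (lbracket L x y) = lzero L" by simp
  moreover have "ladd L (neg (lbracket L y x)) (ladd L (lbracket L y x) (lbracket L x y)) = lbracket L x y"
    using x y by (metis add_left_comm add_neg_cancel bracket_closed smult_closed)
  ultimately show ?thesis using x y by (simp add: add_zero smult_closed bracket_closed)
qed

lemma quot_bracket:
  assumes I: "lie_ideal L I" and x: "x \<in> lcarrier L" and y: "y \<in> lcarrier L"
  shows "lbracket (lie_quot L I) (lie_coset L I x) (lie_coset L I y) = lie_coset L I (lbracket L x y)"
proof -
  have sub: "j \<in> lcarrier L" if "j \<in> I" for j using I that unfolding lie_ideal_def by blast
  have right: "lbracket L a j \<in> I" if "a \<in> lcarrier L" "j \<in> I" for a j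
    using I that unfolding lie_ideal_def by blast
  have left: "lbracket L j a \<in> I" if "a \<in> lcarrier L" "j \<in> I" for a j
    using I right[OF that] bracket_anticomm[OF sub[OF that(2)] that(1)] unfolding lie_ideal_def by simp
  have inner: "(\<Union>b\<in>lie_coset L I y. lie_coset L I (lbracket L a b)) = lie_coset L I (lbracket L a y)"
    if a: "a \<in> lcarrier L" for a
  proof (rule coset_union[OF I y])
    show "\<exists>j\<in>I. lbracket L a (ladd L y i) = ladd L (lbracket L a y) j" if "i \<in> I" for i
      using that a y sub right by (intro bexI[of _ "lbracket L a i"]) (simp_all add: bracket_add_right)
  qed (use a y in \<open>simp add: bracket_closed\<close>)
  have "(\<Union>a\<in>lie_coset L I x. \<Union>b\<in>lie_coset L I y. lie_coset L I (lbracket L a b))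
      = (\<Union>a\<in>lie_coset L I x. lie_coset L I (lbracket L a y))"
    using inner coset_closed[OF I x] by (intro SUP_cong) auto
  also have "\<dots> = lie_coset L I (lbracket L x y)"
  proof (rule coset_union[OF I x])
    show "\<exists>j\<in>I. lbracket L (ladd L x i) y = ladd L (lbracket L x y) j" if "i \<in> I" for i
      using that x y sub left by (intro bexI[of _ "lbracket L i y"]) (simp_all add: bracket_add_left)
  qed (use x y in \<open>simp add: bracket_closed\<close>)
  finally show ?thesis by (simp add: lie_quot_def)
qed

lemma lie_algebra_quot:
  assumes I: "lie_ideal L I"
  shows "lie_algebra (lie_quot L I)"
  by (rule lie_algebra_surjective_image[where f = "lie_coset L I" and L = L])
    (simp_all add: lie_algebra_axioms quot_add[OF I] quot_smult[OF I] quot_bracket[OF I],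
      simp_all add: lie_quot_def)

end

text \<open>Since \<open>I\<close> is the full preimage of \<open>J\<close> under the surjection \<open>g\<close>, taking images under \<open>g\<close> carries
  cosets of \<open>I\<close> to cosets of \<open>J\<close>, and two cosets with the same image differ by an element of \<open>I\<close>.\<close>

lemma lie_isomorphic_quotients:
  assumes g: "lie_hom L M g" and surj: "g ` lcarrier L = lcarrier M"
    and zero: "g (lzero L) = lzero M"
    and J: "lie_ideal M J" and I: "I = {x \<in> lcarrier L. g x \<in> J}"
  shows "lie_isomorphic (lie_quot L I) (lie_quot M J)"
proof -
  interpret lie_hom L M g by (rule g)
  have J_sub: "J \<subseteq> lcarrier M" using J unfolding lie_ideal_def by blast
  have ideal: "lie_ideal L I"
    using J dom.zero_closed dom.add_closed dom.smult_closed dom.bracket_closed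
    unfolding lie_ideal_def I by (auto simp: zero hom_add hom_smult hom_bracket hom_closed)
  have gI: "g ` I = J" using surj J_sub unfolding I by force
  have coset: "g ` lie_coset L I x = lie_coset M J (g x)" if "x \<in> lcarrier L" for x
  proof -
    have "g ` lie_coset L I x = ladd M (g x) ` (g ` I)"
      unfolding lie_coset_def image_image
      using that I by (intro image_cong) (auto simp: hom_add)
    then show ?thesis by (simp add: gI lie_coset_def)
  qed
  have carriers: "lcarrier (lie_quot L I) = lie_coset L I ` lcarrier L"
    "lcarrier (lie_quot M J) = lie_coset M J ` lcarrier M"
    by (simp_all add: lie_quot_def)
  have image: "lcarrier (lie_quot M J) = (`) g ` lcarrier (lie_quot L I)"
    unfolding carriers surj[symmetric] by (force simp: coset image_image)
  have "lie_hom (lie_quot L I) (lie_quot M J) ((`) g)"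
  proof (rule lie_hom_surjective[OF dom.lie_algebra_quot[OF ideal] image], unfold carriers, goal_cases)
    case 1
    then show ?case by (simp add: lie_quot_def coset dom.zero_closed zero)
  next
    case (2 X Y)
    then show ?case
      by (elim imageE) (simp add: dom.quot_add[OF ideal] cod.quot_add[OF J] coset hom_add
          hom_closed dom.add_closed)
  next
    case (3 c X)
    then show ?case
      by (elim imageE) (simp add: dom.quot_smult[OF ideal] cod.quot_smult[OF J] coset hom_smult
          hom_closed dom.smult_closed)
  next
    case (4 X Y)
    then show ?case
      by (elim imageE) (simp add: dom.quot_bracket[OF ideal] cod.quot_bracket[OF J] coset
          hom_bracket hom_closed dom.bracket_closed)
  qed
  moreover have "inj_on ((`) g) (lcarrier (lie_quot L I))"
  proof (rule inj_onI)
    fix X Y assume X: "X \<in> lcarrier (lie_quot L I)" and Y: "Y \<in> lcarrier (lie_quot L I)"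
      and eq: "g ` X = g ` Y"
    obtain x y where x: "x \<in> lcarrier L" "X = lie_coset L I x"
      and y: "y \<in> lcarrier L" "Y = lie_coset L I y" using X Y unfolding carriers by blast
    have "g x \<in> lie_coset M J (g y)"
      using eq x y coset cod.coset_self[OF J] hom_closed by metis
    then obtain j where j: "j \<in> J" "g x = ladd M (g y) j" unfolding lie_coset_def by blast
    define i where "i = ladd L (dom.neg y) x"
    have i: "i \<in> lcarrier L" using x y by (simp add: i_def dom.add_closed dom.smult_closed)
    have xi: "x = ladd L y i" using dom.add_neg_cancel x y i_def by simp
    have "g i = ladd M (cod.neg (g y)) (g x)"
      using x y by (simp add: i_def hom_add hom_smult dom.smult_closed)
    also have "\<dots> = j"
      using j J_sub y hom_closed
      by (simp add: cod.add_left_comm[of "cod.neg (g y)" "g y"] cod.add_neg_cancel cod.smult_closed subset_iff)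
    finally have "x \<in> lie_coset L I y" using xi i j(1) I unfolding lie_coset_def by blast
    then show "X = Y" using dom.coset_eq[OF ideal y(1)] x(2) y(2) by simp
  qed
  ultimately show ?thesis
    unfolding lie_isomorphic_def bij_betw_def using image by blast
qed

section \<open>Plugging inputs with the nullary operation\<close>

sublocale operad \<subseteq> vs: vector_space "scal P"
  by (rule vector_space)

context operad
begin

lemmas arity_closed =
  vs.subspace_0[OF arity_subspace] vs.subspace_add[OF arity_subspace]
  vs.subspace_diff[OF arity_subspace] vs.subspace_scale[OF arity_subspace]

lemmas arity_sum = vs.subspace_sum[OF arity_subspace]

lemma comp_closed:
  "\<lbrakk>i \<in> {1..m}; \<mu> \<in> arity P m; \<nu> \<in> arity P n\<rbrakk> \<Longrightarrow> pcomp P m n i \<mu> \<nu> \<in> arity P (m + n - 1)"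
  using comp_linear_left unfolding linear_between_def by blast

lemma comp_add_left:
  "\<lbrakk>i \<in> {1..m}; \<mu> \<in> arity P m; \<mu>' \<in> arity P m; \<nu> \<in> arity P n\<rbrakk>
    \<Longrightarrow> pcomp P m n i (\<mu> + \<mu>') \<nu> = pcomp P m n i \<mu> \<nu> + pcomp P m n i \<mu>' \<nu>"
  using comp_linear_left unfolding linear_between_def by blast

lemma comp_add_right:
  "\<lbrakk>i \<in> {1..m}; \<mu> \<in> arity P m; \<nu> \<in> arity P n; \<nu>' \<in> arity P n\<rbrakk>
    \<Longrightarrow> pcomp P m n i \<mu> (\<nu> + \<nu>') = pcomp P m n i \<mu> \<nu> + pcomp P m n i \<mu> \<nu>'"
  using comp_linear_right unfolding linear_between_def by blast

lemma comp_scale_left: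
  "\<lbrakk>i \<in> {1..m}; \<mu> \<in> arity P m; \<nu> \<in> arity P n\<rbrakk>
    \<Longrightarrow> pcomp P m n i (scal P c \<mu>) \<nu> = scal P c (pcomp P m n i \<mu> \<nu>)"
  using comp_linear_left unfolding linear_between_def by blast

lemma comp_scale_right:
  "\<lbrakk>i \<in> {1..m}; \<mu> \<in> arity P m; \<nu> \<in> arity P n\<rbrakk>
    \<Longrightarrow> pcomp P m n i \<mu> (scal P c \<nu>) = scal P c (pcomp P m n i \<mu> \<nu>)"
  using comp_linear_right unfolding linear_between_def by blast

lemma comp_diff_left:
  "\<lbrakk>i \<in> {1..m}; \<mu> \<in> arity P m; \<mu>' \<in> arity P m; \<nu> \<in> arity P n\<rbrakk>
    \<Longrightarrow> pcomp P m n i (\<mu> - \<mu>') \<nu> = pcomp P m n i \<mu> \<nu> - pcomp P m n i \<mu>' \<nu>"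
  using linear_between_diff[OF vector_space arity_subspace comp_linear_left] by blast

lemma comp_diff_right:
  "\<lbrakk>i \<in> {1..m}; \<mu> \<in> arity P m; \<nu> \<in> arity P n; \<nu>' \<in> arity P n\<rbrakk>
    \<Longrightarrow> pcomp P m n i \<mu> (\<nu> - \<nu>') = pcomp P m n i \<mu> \<nu> - pcomp P m n i \<mu> \<nu>'"
  using linear_between_diff[OF vector_space arity_subspace comp_linear_right] by blast

lemma comp_zero_left:
  "\<lbrakk>i \<in> {1..m}; \<nu> \<in> arity P n\<rbrakk> \<Longrightarrow> pcomp P m n i 0 \<nu> = 0"
  using linear_between_zero[OF vector_space arity_subspace comp_linear_left] by blast

lemma comp_zero_right:
  "\<lbrakk>i \<in> {1..m}; \<mu> \<in> arity P m\<rbrakk> \<Longrightarrow> pcomp P m n i \<mu> 0 = 0"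
  using linear_between_zero[OF vector_space arity_subspace comp_linear_right] by blast

end

context unitary_operad
begin

text \<open>The vector space of nullary operations is a line; \<open>coord\<close> is the coordinate on it.\<close>

definition coord :: "'a \<Rightarrow> 'k" where
  "coord x = (THE c. x = scal P c u0)"

definition kill :: "nat \<Rightarrow> nat \<Rightarrow> 'a \<Rightarrow> 'a" where
  "kill n i \<theta> = pcomp P n 0 i \<theta> u0"

lemma u0_closed: "u0 \<in> arity P 0"
  using arity_0 vs.scale_one by (metis rangeI)

lemma coord_scale_u0 [simp]: "coord (scal P c u0) = c"
  unfolding coord_def using u0_nonzero by auto

lemma scale_coord: "x \<in> arity P 0 \<Longrightarrow> scal P (coord x) u0 = x"
  using arity_0 by auto

lemma coord_add: "\<lbrakk>x \<in> arity P 0; y \<in> arity P 0\<rbrakk> \<Longrightarrow> coord (x + y) = coord x + coord y"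
  unfolding arity_0 by (auto simp flip: vs.scale_left_distrib)

lemma coord_scale: "x \<in> arity P 0 \<Longrightarrow> coord (scal P c x) = c * coord x"
  unfolding arity_0 by auto

lemma kill_closed: "\<lbrakk>\<theta> \<in> arity P n; i \<in> {1..n}\<rbrakk> \<Longrightarrow> kill n i \<theta> \<in> arity P (n - 1)"
  unfolding kill_def using comp_closed[OF _ _ u0_closed] by simp

lemma kill_add:
  "\<lbrakk>\<theta> \<in> arity P n; \<theta>' \<in> arity P n; i \<in> {1..n}\<rbrakk> \<Longrightarrow> kill n i (\<theta> + \<theta>') = kill n i \<theta> + kill n i \<theta>'"
  unfolding kill_def by (simp add: comp_add_left u0_closed)

lemma kill_diff:
  "\<lbrakk>\<theta> \<in> arity P n; \<theta>' \<in> arity P n; i \<in> {1..n}\<rbrakk> \<Longrightarrow> kill n i (\<theta> - \<theta>') = kill n i \<theta> - kill n i \<theta>'"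
  unfolding kill_def by (simp add: comp_diff_left u0_closed)

lemma kill_scale:
  "\<lbrakk>\<theta> \<in> arity P n; i \<in> {1..n}\<rbrakk> \<Longrightarrow> kill n i (scal P c \<theta>) = scal P c (kill n i \<theta>)"
  unfolding kill_def by (simp add: comp_scale_left u0_closed)

text \<open>This relation, in which the later input has moved down by one, lets a family of plugged inputs
  be plugged in any order.\<close>

lemma kill_kill:
  assumes "\<theta> \<in> arity P n" "1 \<le> i" "i < k" "k \<le> n"
  shows "kill (n - 1) (k - 1) (kill n i \<theta>) = kill (n - 1) i (kill n k \<theta>)"
  using comp_parallel[OF assms(1) u0_closed u0_closed assms(2-4)] unfolding kill_def by simp

text \<open>The axioms for sequential and parallel composition, specialised to \<open>u0\<close>: an input of the
  composite \<open>\<mu> \<circ>\<^sub>i \<nu>\<close> belongs to \<open>\<nu>\<close>, or to \<open>\<mu>\<close> on the left or on the right of \<open>i\<close>, and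
  plugging it plugs that factor.\<close>

lemma kill_comp_inside:
  assumes "\<mu> \<in> arity P m" "\<nu> \<in> arity P n" "i \<in> {1..m}" "j \<in> {1..n}"
  shows "kill (m + n - 1) (i - 1 + j) (pcomp P m n i \<mu> \<nu>) = pcomp P m (n - 1) i \<mu> (kill n j \<nu>)"
  using comp_sequential[OF assms(1,2) u0_closed assms(3,4)] unfolding kill_def by simp

lemma kill_comp_left:
  assumes "\<mu> \<in> arity P m" "\<nu> \<in> arity P n" "i \<le> m" "1 \<le> p" "p < i"
  shows "kill (m + n - 1) p (pcomp P m n i \<mu> \<nu>) = pcomp P (m - 1) n (i - 1) (kill m p \<mu>) \<nu>"
  using comp_parallel[OF assms(1) u0_closed assms(2,4,5,3)] unfolding kill_def by simp

lemma kill_comp_right: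
  assumes "\<mu> \<in> arity P m" "\<nu> \<in> arity P n" "1 \<le> i" "i < p" "p \<le> m"
  shows "kill (m + n - 1) (p - 1 + n) (pcomp P m n i \<mu> \<nu>) = pcomp P (m - 1) n i (kill m p \<mu>) \<nu>"
  using comp_parallel[OF assms(1,2) u0_closed assms(3,4,5)] unfolding kill_def by simp

section \<open>Augmentation and coordinates\<close>

text \<open>\<open>eps n \<theta>\<close> is the scalar left when all inputs of \<open>\<theta>\<close> are plugged, and \<open>res n j \<theta>\<close> is the
  unary operation left when all inputs but \<open>j\<close> are plugged. Both are computed by plugging in a
  fixed order; \<open>eps_kill\<close> and \<open>res_kill\<close> show that the order does not matter.\<close>

primrec eps :: "nat \<Rightarrow> 'a \<Rightarrow> 'k" where
  "eps 0 \<theta> = coord \<theta>"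
| "eps (Suc n) \<theta> = eps n (kill (Suc n) 1 \<theta>)"

fun res :: "nat \<Rightarrow> nat \<Rightarrow> 'a \<Rightarrow> 'a" where
  "res 0 j \<theta> = \<theta>"
| "res (Suc 0) j \<theta> = \<theta>"
| "res (Suc (Suc n)) j \<theta> =
     (if j = Suc (Suc n) then res (Suc n) (Suc n) (kill (Suc (Suc n)) 1 \<theta>)
      else res (Suc n) j (kill (Suc (Suc n)) (Suc (Suc n)) \<theta>))"

lemma augmentation_eps: "augmentation P u0 \<theta> = eps 1 \<theta>"
  by (simp add: augmentation_def kill_def coord_def)

lemma eps_kill: "\<lbrakk>\<theta> \<in> arity P n; i \<in> {1..n}\<rbrakk> \<Longrightarrow> eps (n - 1) (kill n i \<theta>) = eps n \<theta>"
proof (induction n arbitrary: i \<theta>)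
  case (Suc n)
  show ?case
  proof (cases "i = 1")
    case False
    then have i: "i - 1 \<in> {1..n}" "1 < i" "i \<le> Suc n" using Suc.prems(2) by auto
    then obtain k where k: "n = Suc k" by (cases n) auto
    have "eps n (kill (Suc n) i \<theta>) = eps k (kill n 1 (kill (Suc n) i \<theta>))"
      by (simp add: k)
    also have "\<dots> = eps k (kill n (i - 1) (kill (Suc n) 1 \<theta>))"
      using kill_kill[OF Suc.prems(1), of 1 i] i by simp
    also have "\<dots> = eps n (kill (Suc n) 1 \<theta>)"
      using Suc.IH[OF _ i(1), of "kill (Suc n) 1 \<theta>"] kill_closed[OF Suc.prems(1), of 1] k by simp
    finally show ?thesis by simp
  qed simp
qed simp

lemma res_closed: "\<lbrakk>\<theta> \<in> arity P n; j \<in> {1..n}\<rbrakk> \<Longrightarrow> res n j \<theta> \<in> arity P 1"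
proof (induction n j \<theta> rule: res.induct)
  case (3 n j \<theta>)
  have "kill (Suc (Suc n)) 1 \<theta> \<in> arity P (Suc n)" "kill (Suc (Suc n)) (Suc (Suc n)) \<theta> \<in> arity P (Suc n)"
    using kill_closed[OF 3(3)] by force+
  then show ?case using 3 by auto
qed auto

text \<open>The definition of \<open>res\<close> plugs one particular input \<open>k\<close> first. By induction any other input \<open>i\<close>
  may be plugged second, and \<open>kill_kill\<close> exchanges the two.\<close>

lemma res_kill:
  "\<lbrakk>\<theta> \<in> arity P n; i \<in> {1..n}; j \<in> {1..n}; i \<noteq> j\<rbrakk>
    \<Longrightarrow> res (n - 1) (if i < j then j - 1 else j) (kill n i \<theta>) = res n j \<theta>"
proof (induction n arbitrary: i j \<theta>)
  case (Suc n)
  define k where "k = (if j = Suc n then 1 else Suc n)"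
  \<comment> \<open>\<open>del a b\<close> is the position of input \<open>b\<close> after input \<open>a\<close> has been plugged.\<close>
  define del :: "nat \<Rightarrow> nat \<Rightarrow> nat" where "del = (\<lambda>i j. if i < j then j - 1 else j)"
  have n: "n \<noteq> 0" using Suc.prems by auto
  then obtain n' where n': "n = Suc n'" by (cases n) auto
  have k: "k \<in> {1..Suc n}" "k \<noteq> j" using n by (auto simp: k_def)
  have step: "res (Suc n) j \<theta> = res n (del k j) (kill (Suc n) k \<theta>)"
    using Suc.prems(3) by (auto simp: n' k_def del_def)
  show ?case
  proof (cases "i = k")
    case True
    then show ?thesis using step by (simp add: del_def)
  next
    case False
    have cl: "kill (Suc n) k \<theta> \<in> arity P n" "kill (Suc n) i \<theta> \<in> arity P n"
      using kill_closed[OF Suc.prems(1)] k(1) Suc.prems(2) by force+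
    have kk: "kill n (del k i) (kill (Suc n) k \<theta>) = kill n (del i k) (kill (Suc n) i \<theta>)"
      using kill_kill[OF Suc.prems(1), of i k] kill_kill[OF Suc.prems(1), of k i] False k(1) Suc.prems(2)
      by (cases "i < k") (auto simp: del_def)
    have IH: "res (n - 1) (del a b) (kill n a \<phi>) = res n b \<phi>"
      if "\<phi> \<in> arity P n" "a \<in> {1..n}" "b \<in> {1..n}" "a \<noteq> b" for a b \<phi>
      using Suc.IH[OF that] by (simp only: del_def)
    have del_k: "del k i \<in> {1..n}" "del k j \<in> {1..n}" "del k i \<noteq> del k j"
      using False k Suc.prems by (auto simp: del_def)
    have del_i: "del i k \<in> {1..n}" "del i j \<in> {1..n}" "del i k \<noteq> del i j"
      using False k Suc.prems by (auto simp: del_def)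
    have "res n (del k j) (kill (Suc n) k \<theta>)
        = res (n - 1) (del (del k i) (del k j)) (kill n (del k i) (kill (Suc n) k \<theta>))"
      using IH[OF cl(1) del_k] by simp
    also have "del (del k i) (del k j) = del (del i k) (del i j)"
      using False k Suc.prems by (auto simp: del_def)
    also have "res (n - 1) (del (del i k) (del i j)) (kill n (del k i) (kill (Suc n) k \<theta>))
        = res n (del i j) (kill (Suc n) i \<theta>)"
      unfolding kk by (rule IH[OF cl(2) del_i])
    finally show ?thesis using step by (simp add: del_def)
  qed
qed simp

lemma eps_add: "\<lbrakk>\<theta> \<in> arity P n; \<theta>' \<in> arity P n\<rbrakk> \<Longrightarrow> eps n (\<theta> + \<theta>') = eps n \<theta> + eps n \<theta>'"
proof (induction n arbitrary: \<theta> \<theta>')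
  case (Suc n)
  then show ?case using kill_closed[of _ "Suc n" 1] by (simp add: kill_add)
qed (simp add: coord_add)

lemma eps_scale: "\<theta> \<in> arity P n \<Longrightarrow> eps n (scal P c \<theta>) = c * eps n \<theta>"
proof (induction n arbitrary: \<theta>)
  case (Suc n)
  then show ?case using kill_closed[of _ "Suc n" 1] by (simp add: kill_scale)
qed (simp add: coord_scale)

lemma res_add:
  "\<lbrakk>\<theta> \<in> arity P n; \<theta>' \<in> arity P n; j \<in> {1..n}\<rbrakk> \<Longrightarrow> res n j (\<theta> + \<theta>') = res n j \<theta> + res n j \<theta>'"
proof (induction n j \<theta> arbitrary: \<theta>' rule: res.induct)
  case (3 n j \<theta>)
  have "kill (Suc (Suc n)) i \<phi> \<in> arity P (Suc n)" if "\<phi> \<in> {\<theta>, \<theta>'}" "i \<in> {1, Suc (Suc n)}" for i \<phi>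
    using kill_closed[of \<phi> "Suc (Suc n)" i] 3(3,4) that by auto
  then show ?case using 3 by (auto simp: kill_add)
qed auto

lemma res_scale:
  "\<lbrakk>\<theta> \<in> arity P n; j \<in> {1..n}\<rbrakk> \<Longrightarrow> res n j (scal P c \<theta>) = scal P c (res n j \<theta>)"
proof (induction n j \<theta> rule: res.induct)
  case (3 n j \<theta>)
  have "kill (Suc (Suc n)) i \<theta> \<in> arity P (Suc n)" if "i \<in> {1, Suc (Suc n)}" for i
    using kill_closed[of \<theta> "Suc (Suc n)" i] 3(3) that by auto
  then show ?case using 3 by (auto simp: kill_scale)
qed auto

lemma res_linear:
  "j \<in> {1..n} \<Longrightarrow> linear_between (scal P) (arity P n) (arity P 1) (res n j)"
  unfolding linear_between_def using res_closed res_add res_scale by blast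

lemma eps_res: "\<lbrakk>\<theta> \<in> arity P n; j \<in> {1..n}\<rbrakk> \<Longrightarrow> eps 1 (res n j \<theta>) = eps n \<theta>"
proof (induction n j \<theta> rule: res.induct)
  case (3 n j \<theta>)
  have cl: "kill (Suc (Suc n)) i \<theta> \<in> arity P (Suc n)" if "i \<in> {1, Suc (Suc n)}" for i
    using kill_closed[of \<theta> "Suc (Suc n)" i] 3(3) that by auto
  have "eps (Suc n) (kill (Suc (Suc n)) i \<theta>) = eps (Suc (Suc n)) \<theta>" if "i \<in> {1, Suc (Suc n)}" for i
    using eps_kill[OF 3(3), of i] that by auto
  then show ?case using 3 cl by (auto simp del: eps.simps)
qed auto

end

section \<open>Coordinates of composites and of permuted operations\<close>

context unitary_operad
begin

lemma comp_nullary: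
  assumes "\<mu> \<in> arity P m" "\<nu> \<in> arity P 0" "i \<in> {1..m}"
  shows "pcomp P m 0 i \<mu> \<nu> = scal P (coord \<nu>) (kill m i \<mu>)"
proof -
  have "pcomp P m 0 i \<mu> \<nu> = pcomp P m 0 i \<mu> (scal P (coord \<nu>) u0)"
    using assms(2) by (simp add: scale_coord)
  then show ?thesis using assms by (simp add: comp_scale_right u0_closed kill_def)
qed

lemma kill_comp_first:
  assumes "\<mu> \<in> arity P m" "\<nu> \<in> arity P (Suc n)" "i \<in> {1..m}"
  shows "kill (m + n) i (pcomp P m (Suc n) i \<mu> \<nu>) = pcomp P m n i \<mu> (kill (Suc n) 1 \<nu>)"
  using kill_comp_inside[OF assms, of 1] assms(3) by simp

text \<open>Plugging all inputs of \<open>\<nu>\<close> first turns \<open>\<mu> \<circ>\<^sub>i \<nu>\<close> into \<open>eps n \<nu>\<close> times \<open>\<mu>\<close> with its \<open>i\<close>-th input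
  plugged.\<close>

lemma eps_comp:
  assumes "\<mu> \<in> arity P m" "\<nu> \<in> arity P n" "i \<in> {1..m}"
  shows "eps (m + n - 1) (pcomp P m n i \<mu> \<nu>) = eps m \<mu> * eps n \<nu>"
  using assms(2)
proof (induction n arbitrary: \<nu>)
  case 0
  then show ?case
    using assms(1,3) kill_closed[OF assms(1,3)] eps_kill[OF assms(1,3)]
    by (simp add: comp_nullary eps_scale)
next
  case (Suc n)
  have cl: "kill (Suc n) 1 \<nu> \<in> arity P n" using kill_closed[OF Suc.prems, of 1] by simp
  have "eps (m + n) (pcomp P m (Suc n) i \<mu> \<nu>) = eps (m + n - 1) (kill (m + n) i (pcomp P m (Suc n) i \<mu> \<nu>))"
    using eps_kill[of "pcomp P m (Suc n) i \<mu> \<nu>" "m + n" i] comp_closed[OF assms(3,1) Suc.prems] assms(3)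
    by simp
  also have "\<dots> = eps m \<mu> * eps n (kill (Suc n) 1 \<nu>)"
    unfolding kill_comp_first[OF assms(1) Suc.prems assms(3)] by (rule Suc.IH[OF cl])
  finally show ?case by simp
qed

text \<open>An input of \<open>\<mu>\<close> outside the block of \<open>\<nu>\<close> only sees the scalar \<open>eps n \<nu>\<close>, because isolating
  it plugs all the inputs of \<open>\<nu>\<close>.\<close>

lemma res_comp_left:
  assumes "\<mu> \<in> arity P m" "\<nu> \<in> arity P n" "i \<le> m" "1 \<le> p" "p < i"
  shows "res (m + n - 1) p (pcomp P m n i \<mu> \<nu>) = scal P (eps n \<nu>) (res m p \<mu>)"
  using assms(2)
proof (induction n arbitrary: \<nu>)
  case 0
  have "res (m - 1) p (kill m i \<mu>) = res m p \<mu>"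
    using res_kill[OF assms(1), of i p] assms by simp
  moreover have "kill m i \<mu> \<in> arity P (m - 1)" "p \<in> {1..m - 1}"
    using kill_closed[OF assms(1), of i] assms by auto
  ultimately show ?case using 0 assms by (simp add: comp_nullary res_scale)
next
  case (Suc n)
  have i: "i \<in> {1..m}" using assms by simp
  have cl: "kill (Suc n) 1 \<nu> \<in> arity P n" using kill_closed[OF Suc.prems, of 1] by simp
  have "res (m + n) p (pcomp P m (Suc n) i \<mu> \<nu>) = res (m + n - 1) p (kill (m + n) i (pcomp P m (Suc n) i \<mu> \<nu>))"
    using res_kill[of "pcomp P m (Suc n) i \<mu> \<nu>" "m + n" i p] comp_closed[OF i assms(1) Suc.prems] assms
    by simp
  also have "\<dots> = scal P (eps n (kill (Suc n) 1 \<nu>)) (res m p \<mu>)"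
    unfolding kill_comp_first[OF assms(1) Suc.prems i] by (rule Suc.IH[OF cl])
  finally show ?case by simp
qed

lemma res_comp_right:
  assumes "\<mu> \<in> arity P m" "\<nu> \<in> arity P n" "1 \<le> i" "i < p" "p \<le> m"
  shows "res (m + n - 1) (p - 1 + n) (pcomp P m n i \<mu> \<nu>) = scal P (eps n \<nu>) (res m p \<mu>)"
  using assms(2)
proof (induction n arbitrary: \<nu>)
  case 0
  have "res (m - 1) (p - 1) (kill m i \<mu>) = res m p \<mu>"
    using res_kill[OF assms(1), of i p] assms by simp
  moreover have "kill m i \<mu> \<in> arity P (m - 1)" "p - 1 \<in> {1..m - 1}"
    using kill_closed[OF assms(1), of i] assms by auto
  ultimately show ?case using 0 assms by (simp add: comp_nullary res_scale)
next
  case (Suc n)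
  have i: "i \<in> {1..m}" using assms by simp
  have cl: "kill (Suc n) 1 \<nu> \<in> arity P n" using kill_closed[OF Suc.prems, of 1] by simp
  have "res (m + n) (p + n) (pcomp P m (Suc n) i \<mu> \<nu>)
      = res (m + n - 1) (p - 1 + n) (kill (m + n) i (pcomp P m (Suc n) i \<mu> \<nu>))"
    using res_kill[of "pcomp P m (Suc n) i \<mu> \<nu>" "m + n" i "p + n"] comp_closed[OF i assms(1) Suc.prems] assms
    by simp
  also have "\<dots> = scal P (eps n (kill (Suc n) 1 \<nu>)) (res m p \<mu>)"
    unfolding kill_comp_first[OF assms(1) Suc.prems i] by (rule Suc.IH[OF cl])
  finally show ?case using assms by simp
qed

text \<open>Isolating an input of the block of \<open>\<nu>\<close> leaves the chain from that input through \<open>\<nu>\<close> to the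
  \<open>i\<close>-th input of \<open>\<mu>\<close>. The induction plugs the other inputs one at a time, first those of \<open>\<nu>\<close> and
  then those of \<open>\<mu>\<close>.\<close>

lemma res_comp_inside:
  assumes "\<mu> \<in> arity P m" "\<nu> \<in> arity P n" "i \<in> {1..m}" "j \<in> {1..n}"
  shows "res (m + n - 1) (i - 1 + j) (pcomp P m n i \<mu> \<nu>) = pcomp P 1 1 1 (res m i \<mu>) (res n j \<nu>)"
  using assms
proof (induction "m + n" arbitrary: m n \<mu> \<nu> i j rule: less_induct)
  case less
  define \<theta> where "\<theta> = pcomp P m n i \<mu> \<nu>"
  have \<theta>: "\<theta> \<in> arity P (m + n - 1)"
    unfolding \<theta>_def using less.prems by (intro comp_closed)
  consider "n \<ge> 2" | "n = 1" "m \<ge> 2" | "n = 1" "m = 1" using less.prems(3,4) by force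
  then show ?case
  proof cases
    case 1
    define k where "k = (if j = 1 then 2 else 1 :: nat)"
    define j' where "j' = (if k < j then j - 1 else j)"
    have k: "k \<in> {1..n}" "k \<noteq> j" and j': "j' \<in> {1..n - 1}"
      using less.prems(4) 1 by (auto simp: k_def j'_def)
    have idx: "(if i - 1 + k < i - 1 + j then i - 1 + j - 1 else i - 1 + j) = i - 1 + j'"
      using less.prems k by (auto simp: j'_def)
    have pos: "i - 1 + k \<in> {1..m + n - 1}" "i - 1 + j \<in> {1..m + n - 1}" "i - 1 + k \<noteq> i - 1 + j"
      using less.prems(3,4) k by auto
    have "res (m + n - 1) (i - 1 + j) \<theta> = res (m + n - 1 - 1) (i - 1 + j') (kill (m + n - 1) (i - 1 + k) \<theta>)"
      using res_kill[OF \<theta> pos] unfolding idx by simp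
    also have "\<dots> = res (m + (n - 1) - 1) (i - 1 + j') (pcomp P m (n - 1) i \<mu> (kill n k \<nu>))"
      using kill_comp_inside[OF less.prems(1-3) k(1)] 1 by (simp add: \<theta>_def)
    also have "\<dots> = pcomp P 1 1 1 (res m i \<mu>) (res (n - 1) j' (kill n k \<nu>))"
      using less.hyps[OF _ less.prems(1) kill_closed[OF less.prems(2) k(1)] less.prems(3) j'] 1 by simp
    also have "res (n - 1) j' (kill n k \<nu>) = res n j \<nu>"
      using res_kill[OF less.prems(2) k(1) less.prems(4) k(2)] by (simp add: j'_def)
    finally show ?thesis by (simp add: \<theta>_def)
  next
    case 2
    have j: "j = 1" using 2 less.prems(4) by simp
    define p where "p = (if i = 1 then 2 else 1 :: nat)"
    define i' where "i' = (if p < i then i - 1 else i)"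
    have p: "p \<in> {1..m}" "p \<noteq> i" and i': "i' \<in> {1..m - 1}"
      using less.prems(3) 2 by (auto simp: p_def i'_def)
    have "res m i \<theta> = res (m - 1) i' (kill m p \<theta>)"
      using res_kill[of \<theta> m p i] \<theta> p less.prems(3) 2(1) by (simp add: i'_def)
    also have "kill m p \<theta> = pcomp P (m - 1) 1 i' (kill m p \<mu>) \<nu>"
    proof (cases "p < i")
      case True
      then show ?thesis
        using kill_comp_left[OF less.prems(1,2), of i p] less.prems(3) p 2(1) by (simp add: \<theta>_def i'_def)
    next
      case False
      then show ?thesis
        using kill_comp_right[OF less.prems(1,2), of i p] less.prems(3) p 2(1) by (simp add: \<theta>_def i'_def)
    qed
    also have "res (m - 1) i' (pcomp P (m - 1) 1 i' (kill m p \<mu>) \<nu>)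
        = pcomp P 1 1 1 (res (m - 1) i' (kill m p \<mu>)) (res 1 1 \<nu>)"
      using less.hyps[of "m - 1" 1 "kill m p \<mu>" \<nu> i' 1] kill_closed[OF less.prems(1) p(1)] i' 2 less.prems(2)
      by simp
    also have "res (m - 1) i' (kill m p \<mu>) = res m i \<mu>"
      using res_kill[OF less.prems(1) p(1) less.prems(3) p(2)] by (simp add: i'_def)
    finally show ?thesis using 2(1) j less.prems(3) by (simp add: \<theta>_def)
  next
    case 3
    then show ?thesis using less.prems by simp
  qed
qed

text \<open>Plugging an input of a permuted operation permutes the remaining inputs by the permutation
  obtained from \<open>\<sigma>\<close> by deleting one input.\<close>

lemma perm_comp_nullary:
  assumes "p \<in> {1..n - 1}"
  shows "perm_comp n 0 i \<sigma> id p =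
    (let q = \<sigma> (if p < i then p else Suc p) in if q < \<sigma> i then q else q - 1)"
  using assms by (auto simp: perm_comp_def Let_def)

lemma perm_comp_nullary_permutes:
  assumes \<sigma>: "\<sigma> permutes {1..n}" and i: "i \<in> {1..n}"
  shows "perm_comp n 0 i \<sigma> id permutes {1..n - 1}"
proof (rule bij_imp_permutes)
  let ?\<tau> = "perm_comp n 0 i \<sigma> id"
  let ?ins = "\<lambda>p. if p < i then p else Suc p"
  have inj: "\<sigma> p = \<sigma> q \<longleftrightarrow> p = q" for p q
    using permutes_inj[OF \<sigma>] by (simp add: inj_eq)
  have ins: "?ins p \<in> {1..n}" "?ins p \<noteq> i" if "p \<in> {1..n - 1}" for p
    using that by auto
  have range: "\<sigma> (?ins p) \<in> {1..n}" "\<sigma> (?ins p) \<noteq> \<sigma> i" if "p \<in> {1..n - 1}" for p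
    using permutes_in_image[OF \<sigma>] ins[OF that] inj by simp_all
  have \<sigma>i: "\<sigma> i \<in> {1..n}" using permutes_in_image[OF \<sigma>] i by simp
  have "inj_on ?\<tau> {1..n - 1}"
  proof (rule inj_onI)
    fix p q assume p: "p \<in> {1..n - 1}" and q: "q \<in> {1..n - 1}" and eq: "?\<tau> p = ?\<tau> q"
    have "\<sigma> (?ins p) = \<sigma> (?ins q)"
      using eq range(2)[OF p] range(2)[OF q]
      unfolding perm_comp_nullary[OF p] perm_comp_nullary[OF q] Let_def
      by (simp split: if_splits)
    then have "?ins p = ?ins q" unfolding inj .
    then show "p = q" by (auto split: if_splits)
  qed
  moreover have "?\<tau> ` {1..n - 1} \<subseteq> {1..n - 1}"
  proof (rule image_subsetI)
    fix p assume p: "p \<in> {1..n - 1}"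
    show "?\<tau> p \<in> {1..n - 1}"
      using range[OF p] \<sigma>i unfolding perm_comp_nullary[OF p] Let_def by auto
  qed
  ultimately show "bij_betw ?\<tau> {1..n - 1} {1..n - 1}"
    by (simp add: bij_betw_def endo_inj_surj)
  show "?\<tau> x = x" if "x \<notin> {1..n - 1}" for x
    using that by (auto simp: perm_comp_def Let_def)
qed

lemma kill_act:
  assumes "\<theta> \<in> arity P n" "\<sigma> permutes {1..n}" "i \<in> {1..n}"
  shows "kill n i (pact P n \<theta> \<sigma>) = pact P (n - 1) (kill n (\<sigma> i) \<theta>) (perm_comp n 0 i \<sigma> id)"
  using comp_equivariant[OF assms(1) u0_closed assms(3,2), of id] act_id[OF u0_closed]
  by (simp add: kill_def permutes_id)

lemma res_act:
  assumes "\<theta> \<in> arity P n" "\<sigma> permutes {1..n}" "k \<in> {1..n}"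
  shows "res n k (pact P n \<theta> \<sigma>) = res n (\<sigma> k) \<theta>"
  using assms
proof (induction n arbitrary: \<theta> \<sigma> k)
  case (Suc n)
  have act: "pact P (Suc n) \<theta> \<sigma> \<in> arity P (Suc n)"
    using act_linear[OF Suc.prems(2)] Suc.prems(1) unfolding linear_between_def by blast
  show ?case
  proof (cases "n = 0")
    case True
    then have "\<sigma> = id" using Suc.prems(2) by (simp add: permutes_sing)
    then show ?thesis using act_id[OF Suc.prems(1)] by (metis id_apply)
  next
    case False
    define i where "i = (if k = 1 then 2 else 1 :: nat)"
    define k' where "k' = (if i < k then k - 1 else k)"
    define \<tau> where "\<tau> = perm_comp (Suc n) 0 i \<sigma> id"
    have i: "i \<in> {1..Suc n}" "i \<noteq> k" and k': "k' \<in> {1..n}"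
      using False Suc.prems(3) by (auto simp: i_def k'_def)
    have \<sigma>: "\<sigma> i \<in> {1..Suc n}" "\<sigma> k \<in> {1..Suc n}" "\<sigma> i \<noteq> \<sigma> k"
      using permutes_in_image[OF Suc.prems(2)] permutes_inj[OF Suc.prems(2)] i Suc.prems(3)
      by (auto simp: inj_eq)
    have \<tau>: "\<tau> permutes {1..n}"
      using perm_comp_nullary_permutes[OF Suc.prems(2) i(1)] by (simp add: \<tau>_def)
    have "(if k' < i then k' else Suc k') = k"
      using i Suc.prems(3) by (auto simp: k'_def)
    then have \<tau>k: "\<tau> k' = (if \<sigma> i < \<sigma> k then \<sigma> k - 1 else \<sigma> k)"
      using k' \<sigma>(3) perm_comp_nullary[of k' "Suc n" i \<sigma>] by (simp add: \<tau>_def Let_def)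
    have cl: "kill (Suc n) (\<sigma> i) \<theta> \<in> arity P n" using kill_closed[OF Suc.prems(1) \<sigma>(1)] by simp
    have "res (Suc n) k (pact P (Suc n) \<theta> \<sigma>) = res n k' (kill (Suc n) i (pact P (Suc n) \<theta> \<sigma>))"
      using res_kill[OF act i(1) Suc.prems(3) i(2)] by (simp add: k'_def)
    also have "\<dots> = res n k' (pact P n (kill (Suc n) (\<sigma> i) \<theta>) \<tau>)"
      using kill_act[OF Suc.prems(1,2) i(1)] by (simp add: \<tau>_def)
    also have "\<dots> = res n (\<tau> k') (kill (Suc n) (\<sigma> i) \<theta>)"
      by (rule Suc.IH[OF cl \<tau> k'])
    also have "\<dots> = res (Suc n) (\<sigma> k) \<theta>"
      using res_kill[OF Suc.prems(1) \<sigma>] by (simp add: \<tau>k)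
    finally show ?thesis .
  qed
qed simp

lemma eps_one: "eps 1 (pone P) = 1"
proof -
  have "kill 1 1 (pone P) = scal P 1 u0" using one_comp[OF u0_closed] by (simp add: kill_def)
  then show ?thesis by (simp del: vs.scale_one)
qed

end

section \<open>The unit of each arity\<close>

context two_unitary_operad
begin

definition u2 :: 'a where
  "u2 = (SOME u2. u2 \<in> arity P 2 \<and> pcomp P 2 0 1 u2 u0 = pone P \<and> pcomp P 2 0 2 u2 u0 = pone P)"

lemma u2_closed: "u2 \<in> arity P 2"
  and kill_u2: "kill 2 1 u2 = pone P" "kill 2 2 u2 = pone P"
proof -
  have "\<exists>u2. u2 \<in> arity P 2 \<and> pcomp P 2 0 1 u2 u0 = pone P \<and> pcomp P 2 0 2 u2 u0 = pone P"
    using ex_u2 by blast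
  from someI_ex[OF this] show "u2 \<in> arity P 2" "kill 2 1 u2 = pone P" "kill 2 2 u2 = pone P"
    by (auto simp: u2_def kill_def)
qed

lemma res_u2: "res 2 1 u2 = pone P" "res 2 2 u2 = pone P"
  using kill_u2 unfolding numeral_2_eq_2 by simp_all

text \<open>The \<open>n\<close>-fold product \<open>x\<^sub>1 \<cdots> x\<^sub>n\<close> formed with the multiplication \<open>u2\<close>. As \<open>u0\<close> is a two-sided
  unit for \<open>u2\<close>, all its coordinates are the identity.\<close>

fun unit_of :: "nat \<Rightarrow> 'a" where
  "unit_of 0 = u0"
| "unit_of (Suc 0) = pone P"
| "unit_of (Suc (Suc n)) = pcomp P 2 (Suc n) 1 u2 (unit_of (Suc n))"

lemma unit_of_closed: "unit_of n \<in> arity P n"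
proof (induction n rule: unit_of.induct)
  case (3 n)
  then show ?case using comp_closed[OF _ u2_closed, of 1 "unit_of (Suc n)" "Suc n"] by simp
qed (use u0_closed one_closed in auto)

lemma res_unit_of: "k \<in> {1..n} \<Longrightarrow> res n k (unit_of n) = pone P"
proof (induction n arbitrary: k rule: unit_of.induct)
  case (3 n)
  have cl: "unit_of (Suc n) \<in> arity P (Suc n)" by (rule unit_of_closed)
  show ?case
  proof (cases "k = Suc (Suc n)")
    case False
    then have k: "k \<in> {1..Suc n}" using 3(2) by auto
    then have "res (Suc (Suc n)) k (unit_of (Suc (Suc n))) = pcomp P 1 1 1 (res 2 1 u2) (res (Suc n) k (unit_of (Suc n)))"
      using res_comp_inside[OF u2_closed cl, of 1 k] by (simp del: res.simps)
    then show ?thesis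
      using 3(1)[OF k] res_u2(1) one_comp[OF one_closed] by (simp del: res.simps unit_of.simps)
  next
    case True
    have "eps (Suc n) (unit_of (Suc n)) = 1"
      using eps_res[OF cl, of 1] 3(1)[of 1] eps_one by (simp del: res.simps unit_of.simps eps.simps)
    then show ?thesis
      using res_comp_right[OF u2_closed cl, of 1 2] True res_u2(2) by (simp del: res.simps eps.simps)
  qed
qed auto

text \<open>Composing the \<open>n\<close>-fold product with \<open>a\<close> at input \<open>j\<close> realises the coordinate vector with entry
  \<open>a\<close> at \<open>j\<close> and \<open>0\<close> elsewhere. The other entries vanish because \<open>a\<close> lies in the augmentation
  ideal.\<close>

lemma res_insert_aug:
  assumes a: "a \<in> arity P 1" "eps 1 a = 0" and j: "j \<in> {1..n}" and k: "k \<in> {1..n}"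
  shows "res n k (pcomp P n 1 j (unit_of n) a) = (if k = j then a else 0)"
proof -
  consider "k = j" | "k < j" | "j < k" by linarith
  then show ?thesis
  proof cases
    case 1
    then show ?thesis
      using res_comp_inside[OF unit_of_closed a(1) j, of 1] res_unit_of[OF j] one_comp[OF a(1)] j by simp
  next
    case 2
    then show ?thesis using res_comp_left[OF unit_of_closed a(1), of j n k] a(2) j k by simp
  next
    case 3
    then show ?thesis using res_comp_right[OF unit_of_closed a(1), of j k n] a(2) j k by simp
  qed
qed

end

section \<open>Dimension growth\<close>

text \<open>A lower bound for the dimension that is also meaningful for spaces not known to be finite
  dimensional.\<close>

definition has_rank :: "('k::field \<Rightarrow> 'a \<Rightarrow> 'a::ab_group_add) \<Rightarrow> nat \<Rightarrow> 'a set \<Rightarrow> bool" where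
  "has_rank s k V \<longleftrightarrow> (\<exists>S\<subseteq>V. finite S \<and> \<not> module.dependent s S \<and> card S = k)"

lemma has_rank_singleton:
  assumes "vector_space s" "x \<in> V" "x \<noteq> 0"
  shows "has_rank s 1 V"
proof -
  interpret vector_space s by fact
  show ?thesis unfolding has_rank_def
    using assms by (intro exI[of _ "{x}"]) (auto simp: independent_insert)
qed

lemma has_rank_le_dim:
  assumes "vector_space s" "has_rank s k V" "finite_dim_subspace s V"
  shows "k \<le> vector_space.dim s V"
proof -
  interpret vector_space s by fact
  obtain S where S: "S \<subseteq> V" "independent S" "card S = k"
    using assms(2) unfolding has_rank_def by blast
  obtain B where B: "finite B" "span B = V"
    using assms(3) unfolding finite_dim_subspace_def by blast
  obtain C where C: "C \<subseteq> V" "independent C" "V \<subseteq> span C" "card C = dim V"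
    by (rule basis_exists)
  have "finite C" using independent_span_bound[OF B(1) C(2)] B(2) C(1) by blast
  then show ?thesis using independent_span_bound[of C S] S C by auto
qed

text \<open>Rank--nullity, as a lower bound: the ranks of the image and of the kernel of \<open>T\<close> add up.\<close>

lemma has_rank_extension:
  assumes s: "vector_space s" and A: "module.subspace s A" and T: "linear_between s A B T"
    and V: "V \<subseteq> A"
    and image: "has_rank s k U" "\<And>x. x \<in> U \<Longrightarrow> \<exists>y\<in>V. T y = x"
    and kernel: "has_rank s l {y \<in> V. T y = 0}"
  shows "has_rank s (k + l) V"
proof -
  interpret vector_space s by fact
  obtain X where X: "X \<subseteq> U" "finite X" "independent X" "card X = k"
    using image(1) unfolding has_rank_def by blast
  obtain Y where Y: "Y \<subseteq> V" "\<And>y. y \<in> Y \<Longrightarrow> T y = 0" "finite Y" "independent Y" "card Y = l"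
    using kernel unfolding has_rank_def by blast
  obtain lift where lift: "\<And>x. x \<in> U \<Longrightarrow> lift x \<in> V" "\<And>x. x \<in> U \<Longrightarrow> T (lift x) = x"
    using image(2) by metis
  have inj: "inj_on lift X"
    using lift(2) X(1) by (metis inj_onI subsetD)
  have "0 \<notin> X" using X(3) dependent_zero by blast
  then have disj: "lift ` X \<inter> Y = {}"
    using lift(2) X(1) Y(2) by force
  have T_scale: "T (s c y) = s c (T y)" if "y \<in> V" for c y
    using T V that unfolding linear_between_def by blast
  have T_add: "T (x + y) = T x + T y" if "x \<in> A" "y \<in> A" for x y
    using T that unfolding linear_between_def by blast
  have scale_A: "s c y \<in> A" if "y \<in> V" for c y
    using V that subspace_scale[OF A] by blast
  have "independent (lift ` X \<union> Y)"
  proof (rule independent_if_scalars_zero)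
    fix f z assume zero: "(\<Sum>v\<in>lift ` X \<union> Y. s (f v) v) = 0" and z: "z \<in> lift ` X \<union> Y"
    have split: "(\<Sum>v\<in>lift ` X \<union> Y. s (f v) v) = (\<Sum>x\<in>X. s (f (lift x)) (lift x)) + (\<Sum>y\<in>Y. s (f y) y)"
      using X(2) Y(3) disj inj by (simp add: sum.union_disjoint sum.reindex)
    have mem: "(\<Sum>x\<in>X. s (f (lift x)) (lift x)) \<in> A" "(\<Sum>y\<in>Y. s (f y) y) \<in> A"
      using lift(1) X(1) Y(1) by (auto intro!: subspace_sum[OF A] scale_A)
    have "T (\<Sum>y\<in>Y. s (f y) y) = (\<Sum>y\<in>Y. T (s (f y) y))"
      using Y(1) by (intro linear_between_sum[OF s A T]) (auto intro: scale_A)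
    also have "\<dots> = 0"
      using Y(1,2) T_scale by (intro sum.neutral) auto
    finally have TY: "T (\<Sum>y\<in>Y. s (f y) y) = 0" .
    have "T (\<Sum>x\<in>X. s (f (lift x)) (lift x)) = (\<Sum>x\<in>X. T (s (f (lift x)) (lift x)))"
      using X(1) lift(1) by (intro linear_between_sum[OF s A T]) (auto intro: scale_A)
    also have "\<dots> = (\<Sum>x\<in>X. s (f (lift x)) x)"
      using X(1) lift T_scale by (intro sum.cong) auto
    finally have TX: "T (\<Sum>x\<in>X. s (f (lift x)) (lift x)) = (\<Sum>x\<in>X. s (f (lift x)) x)" .
    have "T 0 = 0" by (rule linear_between_zero[OF s A T])
    then have "(\<Sum>x\<in>X. s (f (lift x)) x) = 0"
      using zero T_add[OF mem] TX TY unfolding split by simp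
    then have fX: "f (lift x) = 0" if "x \<in> X" for x
      using independentD[OF X(3,2) subset_refl, of "\<lambda>x. f (lift x)"] that by blast
    then have "(\<Sum>y\<in>Y. s (f y) y) = 0"
      using zero unfolding split by simp
    then have "f y = 0" if "y \<in> Y" for y
      using independentD[OF Y(4,3) subset_refl, of f] that by blast
    then show "f z = 0" using fX z by blast
  qed (use X(2) Y(3) in simp)
  moreover have "card (lift ` X \<union> Y) = k + l"
    using X(2,4) Y(3,5) disj inj by (simp add: card_Un_disjoint card_image)
  moreover have "lift ` X \<union> Y \<subseteq> V" using lift(1) X(1) Y(1) by blast
  ultimately show ?thesis
    unfolding has_rank_def using X(2) Y(3) by (intro exI[of _ "lift ` X \<union> Y"]) simp
qed

context two_unitary_operad
begin

lemma kill_linear: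
  "i \<in> {1..n} \<Longrightarrow> linear_between (scal P) (arity P n) (arity P (n - 1)) (kill n i)"
  unfolding linear_between_def using kill_closed kill_add kill_scale by blast

text \<open>The multiplication \<open>u2\<close> adds a dummy input after the last or before the first one. These are
  sections of plugging the last or the first input.\<close>

lemma append_input:
  assumes x: "x \<in> arity P n"
  shows "pcomp P 2 n 1 u2 x \<in> arity P (Suc n)"
    and "kill (Suc n) (Suc n) (pcomp P 2 n 1 u2 x) = x"
  using comp_closed[OF _ u2_closed x, of 1] kill_comp_right[OF u2_closed x, of 1 2] kill_u2 one_comp[OF x]
  by simp_all

lemma prepend_input:
  assumes x: "x \<in> arity P n"
  shows "pcomp P 2 n 2 u2 x \<in> arity P (Suc n)"
    and "kill (Suc n) 1 (pcomp P 2 n 2 u2 x) = x"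
    and "j \<in> {1..n} \<Longrightarrow> kill (Suc n) (Suc j) (pcomp P 2 n 2 u2 x) = pcomp P 2 (n - 1) 2 u2 (kill n j x)"
  using comp_closed[OF _ u2_closed x, of 2] kill_comp_left[OF u2_closed x, of 2 1] kill_u2 one_comp[OF x]
    kill_comp_inside[OF u2_closed x, of 2 j]
  by simp_all

definition last_killed :: "nat \<Rightarrow> 'a set" where
  "last_killed n = {\<theta> \<in> arity P n. kill n n \<theta> = 0}"

definition ends_killed :: "nat \<Rightarrow> 'a set" where
  "ends_killed n = {\<theta> \<in> last_killed n. kill n 1 \<theta> = 0}"

text \<open>A dummy input can also be created inside: \<open>\<theta>(x\<^sub>1 x\<^sub>2, x\<^sub>3, \<dots>)\<close> with \<open>x\<^sub>1 = 1\<close> or \<open>x\<^sub>2 = 1\<close> gives back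
  \<open>\<theta>\<close>, and subtracting \<open>x\<^sub>1 \<theta>(x\<^sub>2, x\<^sub>3, \<dots>)\<close> cancels the first of these while keeping the second. So
  the difference is nonzero and still dies when either end is plugged.\<close>

lemma ends_killed_Suc:
  assumes n: "n \<ge> 2" and \<theta>: "\<theta> \<in> ends_killed n" "\<theta> \<noteq> 0"
  shows "\<exists>\<theta>'\<in>ends_killed (Suc n). \<theta>' \<noteq> 0"
proof (rule bexI)
  let ?a = "pcomp P n 2 1 \<theta> u2" and ?b = "pcomp P 2 n 2 u2 \<theta>"
  have cl: "\<theta> \<in> arity P n" and last: "kill n n \<theta> = 0" and first: "kill n 1 \<theta> = 0"
    using \<theta> by (auto simp: ends_killed_def last_killed_def)
  have one: "1 \<in> {1..n}" and a: "?a \<in> arity P (Suc n)" and b: "?b \<in> arity P (Suc n)"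
    using n comp_closed[OF _ cl u2_closed, of 1] prepend_input(1)[OF cl] by auto
  have "kill (Suc n) 1 ?a = \<theta>"
    using kill_comp_inside[OF cl u2_closed one, of 1] kill_u2 comp_one[OF cl one] by simp
  moreover have "kill (Suc n) 1 ?b = \<theta>"
    by (rule prepend_input(2)[OF cl])
  ultimately have k1: "kill (Suc n) 1 (?a - ?b) = 0"
    using kill_diff[OF a b] by simp
  have "kill (Suc n) (Suc n) ?a = 0"
    using kill_comp_right[OF cl u2_closed, of 1 n] n last comp_zero_left[OF _ u2_closed, of 1 "n - 1"]
    by simp
  moreover have "kill (Suc n) (Suc n) ?b = 0"
    using prepend_input(3)[OF cl, of n] n last comp_zero_right[OF _ u2_closed, of 2 "n - 1"]
    by simp
  ultimately have kn: "kill (Suc n) (Suc n) (?a - ?b) = 0"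
    using kill_diff[OF a b] by simp
  have "kill (Suc n) 2 ?a = \<theta>"
    using kill_comp_inside[OF cl u2_closed one, of 2] kill_u2 comp_one[OF cl one]
    by (simp add: numeral_2_eq_2)
  moreover have "kill (Suc n) 2 ?b = 0"
    using prepend_input(3)[OF cl one] first comp_zero_right[OF _ u2_closed, of 2 "n - 1"]
    by (simp add: numeral_2_eq_2)
  ultimately have "kill (Suc n) 2 (?a - ?b) = \<theta>"
    using kill_diff[OF a b, of 2] n by simp
  then show "?a - ?b \<noteq> 0"
    using \<theta>(2) kill_diff[OF a a, of 2] n by auto
  show "?a - ?b \<in> ends_killed (Suc n)"
    using k1 kn arity_closed(3)[OF a b] by (simp add: ends_killed_def last_killed_def)
qed

text \<open>The kernel of plugging the last input of an operation is \<open>last_killed\<close>, and inside that space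
  the kernel of plugging the first input is \<open>ends_killed\<close>. Each of the two surjections contributes
  one summation to the growth of dimensions.\<close>

lemma rank_arity_Suc:
  assumes "has_rank (scal P) k (arity P n)" "has_rank (scal P) l (last_killed (Suc n))"
  shows "has_rank (scal P) (k + l) (arity P (Suc n))"
proof (rule has_rank_extension[OF vector_space arity_subspace kill_linear subset_refl assms(1)])
  show "\<exists>y\<in>arity P (Suc n). kill (Suc n) (Suc n) y = x" if "x \<in> arity P n" for x
    using append_input[OF that] by blast
  show "has_rank (scal P) l {y \<in> arity P (Suc n). kill (Suc n) (Suc n) y = 0}"
    using assms(2) by (simp add: last_killed_def)
qed simp

lemma rank_last_killed_Suc:
  assumes n: "n > 0" and k: "has_rank (scal P) k (last_killed n)"
    and \<theta>: "\<theta> \<in> ends_killed (Suc n)" "\<theta> \<noteq> 0"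
  shows "has_rank (scal P) (Suc k) (last_killed (Suc n))"
proof -
  have "has_rank (scal P) (k + 1) (last_killed (Suc n))"
  proof (rule has_rank_extension[OF vector_space arity_subspace kill_linear _ k])
    show "\<exists>y\<in>last_killed (Suc n). kill (Suc n) 1 y = x" if "x \<in> last_killed n" for x
    proof (rule bexI)
      have x: "x \<in> arity P n" "kill n n x = 0" using that by (auto simp: last_killed_def)
      show "kill (Suc n) 1 (pcomp P 2 n 2 u2 x) = x" by (rule prepend_input(2)[OF x(1)])
      show "pcomp P 2 n 2 u2 x \<in> last_killed (Suc n)"
        using prepend_input(1)[OF x(1)] prepend_input(3)[OF x(1), of n] n x(2) comp_zero_right[OF _ u2_closed, of 2 "n - 1"]
        by (simp add: last_killed_def)
    qed
    show "has_rank (scal P) 1 {y \<in> last_killed (Suc n). kill (Suc n) 1 y = 0}"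
      using has_rank_singleton[OF vector_space \<theta>] by (simp add: ends_killed_def)
  qed (auto simp: last_killed_def)
  then show ?thesis by simp
qed

text \<open>From arity \<open>m\<close> on, \<open>ends_killed\<close> is nonzero, hence \<open>last_killed\<close> grows at least linearly and
  the space of all operations at least quadratically.\<close>

lemma rank_lower_bound:
  assumes m: "m \<ge> 2" and \<theta>: "\<theta> \<in> arity P m" "\<theta> \<noteq> 0" and killed: "\<And>i. i \<in> {1..m} \<Longrightarrow> kill m i \<theta> = 0"
  shows "has_rank (scal P) (\<Sum>j\<le>k. Suc j) (arity P (m + k))"
proof -
  have ends: "\<exists>\<theta>\<in>ends_killed (m + k). \<theta> \<noteq> 0" for k
  proof (induction k)
    case 0
    then show ?case using \<theta> killed[of 1] killed[of m] m by (auto simp: ends_killed_def last_killed_def)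
  next
    case (Suc k)
    then show ?case using ends_killed_Suc[of "m + k"] m by auto
  qed
  have last: "has_rank (scal P) (Suc k) (last_killed (m + k))" for k
  proof (induction k)
    case 0
    then show ?case
      using has_rank_singleton[OF vector_space, of \<theta> "last_killed m"] \<theta> killed[of m] m
      by (auto simp: last_killed_def)
  next
    case (Suc k)
    then show ?case using ends[of "Suc k"] rank_last_killed_Suc[of "m + k"] m by auto
  qed
  show ?thesis
  proof (induction k)
    case 0
    then show ?case using has_rank_singleton[OF vector_space \<theta>] by simp
  next
    case (Suc k)
    then show ?case using rank_arity_Suc[OF Suc last[of "Suc k", simplified]] by simp
  qed
qed

lemma cubic_growth: "k ^ 3 \<le> 6 * (\<Sum>i\<le>k. \<Sum>j\<le>i. Suc j)"
proof (induction k)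
  case (Suc k)
  have quadratic: "(k + 2) * (k + 1) = 2 * (\<Sum>j\<le>k. Suc j)" for k :: nat
    by (induction k) (simp_all add: algebra_simps)
  have "6 * (\<Sum>i\<le>Suc k. \<Sum>j\<le>i. Suc j) = 6 * (\<Sum>i\<le>k. \<Sum>j\<le>i. Suc j) + 3 * ((Suc k + 2) * (Suc k + 1))"
    unfolding quadratic by simp
  then show ?case using Suc by (simp add: power3_eq_cube algebra_simps)
qed simp

text \<open>The only use of the growth hypothesis. A nonzero operation of arity \<open>m \<ge> 2\<close> killed by plugging
  any input would make the sums of dimensions grow at least cubically, which contradicts
  \<open>GKdim P < 3\<close>.\<close>

lemma kill_jointly_injective:
  assumes GK: "GKdim P = 2" and m: "m \<ge> 2" and \<theta>: "\<theta> \<in> arity P m"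
    and killed: "\<And>i. i \<in> {1..m} \<Longrightarrow> kill m i \<theta> = 0"
  shows "\<theta> = 0"
proof (rule ccontr)
  assume nz: "\<theta> \<noteq> 0"
  define S where "S n = (\<Sum>i\<le>n. vs.dim (arity P i))" for n
  define f :: "nat \<Rightarrow> ereal" where "f n = (if \<forall>i\<le>n. finite_dim_subspace (scal P) (arity P i)
     then ereal (log (real n) (real (S n))) else \<infinity>)" for n
  have "limsup f = 2" using GK unfolding GKdim_def f_def S_def .
  \<comment> \<open>Any exponent strictly between \<open>2\<close> and \<open>3\<close> separates the hypothesis from cubic growth.\<close>
  then have "limsup f < ereal (5/2)" by simp
  then have "eventually (\<lambda>n. f n < ereal (5/2)) sequentially" by (rule Limsup_lessD)
  then obtain N where N: "\<And>n. n \<ge> N \<Longrightarrow> f n < ereal (5/2)"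
    unfolding eventually_sequentially by blast
  have fin: "finite_dim_subspace (scal P) (arity P i)" for i
    using N[of "max i N"] unfolding f_def by (auto split: if_splits)
  have log_less: "log (real n) (real (S n)) < 5/2" if "n \<ge> N" for n
    using N[OF that] fin unfolding f_def by simp
  have lower: "k ^ 3 \<le> 6 * S (m + k)" for k
  proof -
    have "(\<Sum>i\<le>k. \<Sum>j\<le>i. Suc j) \<le> (\<Sum>i\<le>k. vs.dim (arity P (m + i)))"
      using has_rank_le_dim[OF vector_space rank_lower_bound[OF m \<theta> nz killed] fin]
      by (intro sum_mono) blast
    also have "\<dots> = (\<Sum>i\<in>(+) m ` {..k}. vs.dim (arity P i))"
      by (simp add: sum.reindex)
    also have "\<dots> \<le> S (m + k)"
      unfolding S_def by (intro sum_mono2) auto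
    finally show ?thesis using cubic_growth[of k] by linarith
  qed
  have "eventually (\<lambda>k. real (m + k) powr (5/2) < real k ^ 3 / 6) sequentially"
    unfolding of_nat_add by real_asymp
  then obtain K where K: "\<And>k. k \<ge> K \<Longrightarrow> real (m + k) powr (5/2) < real k ^ 3 / 6"
    unfolding eventually_sequentially by blast
  define k where "k = max K N + 1"
  have k_ge: "k \<ge> K" "k \<ge> N" "k > 0" by (simp_all add: k_def)
  have "real k ^ 3 \<le> 6 * real (S (m + k))"
    using lower[of k] by (metis of_nat_le_iff of_nat_mult of_nat_numeral of_nat_power)
  then have less: "real (m + k) powr (5/2) < real (S (m + k))"
    using K[of k] k_ge by linarith
  have "S (m + k) > 0"
    using lower[of k] k_ge(3) by (intro gr0I) simp
  then have "real (S (m + k)) < real (m + k) powr (5/2)"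
    using log_less[of "m + k"] m k_ge log_less_iff[of "real (m + k)" "real (S (m + k))" "5/2"] by simp
  then show False using less by simp
qed

end

section \<open>Derivations of the augmentation ideal\<close>

context unitary_operad
begin

abbreviation umult (infixl "\<odot>" 70) where
  "umult \<equiv> pcomp P 1 1 1"

abbreviation aug where
  "aug \<equiv> aug_ideal P u0"

lemma aug_simps [simp]:
  "alg_scale aug = scal P" "alg_mult aug = umult"
  by (simp_all add: aug_ideal_def)

lemma aug_iff: "x \<in> alg_carrier aug \<longleftrightarrow> x \<in> arity P 1 \<and> eps 1 x = 0"
  by (simp add: aug_ideal_def augmentation_eps del: eps.simps One_nat_def)

lemma umult_closed: "\<lbrakk>x \<in> arity P 1; y \<in> arity P 1\<rbrakk> \<Longrightarrow> x \<odot> y \<in> arity P 1"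
  using comp_closed[of 1 1 x y 1] by simp

lemma umult_assoc:
  "\<lbrakk>x \<in> arity P 1; y \<in> arity P 1; z \<in> arity P 1\<rbrakk> \<Longrightarrow> (x \<odot> y) \<odot> z = x \<odot> (y \<odot> z)"
  using comp_sequential[of x 1 y 1 z 1 1 1] by simp

lemma umult_distribs:
  assumes "x \<in> arity P 1" "y \<in> arity P 1" "z \<in> arity P 1"
  shows "(x + y) \<odot> z = x \<odot> z + y \<odot> z" "z \<odot> (x + y) = z \<odot> x + z \<odot> y"
    "(x - y) \<odot> z = x \<odot> z - y \<odot> z" "z \<odot> (x - y) = z \<odot> x - z \<odot> y"
  using assms by (simp_all add: comp_add_left comp_add_right comp_diff_left comp_diff_right)

lemma umult_scale:
  assumes "x \<in> arity P 1" "z \<in> arity P 1"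
  shows "scal P c x \<odot> z = scal P c (x \<odot> z)" "z \<odot> scal P c x = scal P c (z \<odot> x)"
  using assms by (simp_all add: comp_scale_left comp_scale_right)

lemma umult_one: "x \<in> arity P 1 \<Longrightarrow> pone P \<odot> x = x" "x \<in> arity P 1 \<Longrightarrow> x \<odot> pone P = x"
  using one_comp comp_one[of x 1 1] by simp_all

lemma eps_umult: "\<lbrakk>x \<in> arity P 1; y \<in> arity P 1\<rbrakk> \<Longrightarrow> eps 1 (x \<odot> y) = eps 1 x * eps 1 y"
  using eps_comp[of x 1 y 1 1] by (simp del: eps.simps)

lemma eps_diff: "\<lbrakk>\<theta> \<in> arity P n; \<theta>' \<in> arity P n\<rbrakk> \<Longrightarrow> eps n (\<theta> - \<theta>') = eps n \<theta> - eps n \<theta>'"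
  using eps_add[of "\<theta> - \<theta>'" n \<theta>'] arity_closed(3) by (simp add: eq_diff_eq)

lemma res_diff:
  "\<lbrakk>\<theta> \<in> arity P n; \<theta>' \<in> arity P n; j \<in> {1..n}\<rbrakk> \<Longrightarrow> res n j (\<theta> - \<theta>') = res n j \<theta> - res n j \<theta>'"
  using linear_between_diff[OF vector_space arity_subspace res_linear] by blast

lemma eps_zero: "eps n 0 = 0"
  using eps_scale[OF arity_closed(1), of n 0] by simp

lemma aug_closed:
  "0 \<in> alg_carrier aug"
  "\<lbrakk>x \<in> alg_carrier aug; y \<in> alg_carrier aug\<rbrakk> \<Longrightarrow> x + y \<in> alg_carrier aug"
  "\<lbrakk>x \<in> alg_carrier aug; y \<in> alg_carrier aug\<rbrakk> \<Longrightarrow> x - y \<in> alg_carrier aug"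
  "x \<in> alg_carrier aug \<Longrightarrow> scal P c x \<in> alg_carrier aug"
  "\<lbrakk>x \<in> alg_carrier aug; y \<in> alg_carrier aug\<rbrakk> \<Longrightarrow> x \<odot> y \<in> alg_carrier aug"
  by (auto simp: aug_iff arity_closed umult_closed eps_zero eps_add eps_diff eps_scale eps_umult
      simp del: eps.simps One_nat_def)

lemma aug_subspace: "vs.subspace (alg_carrier aug)"
  by (intro vs.subspaceI aug_closed)

lemma aug_arity: "x \<in> alg_carrier aug \<Longrightarrow> x \<in> arity P 1"
  by (simp add: aug_iff)

lemma aug_part: "x \<in> arity P 1 \<Longrightarrow> x - scal P (eps 1 x) (pone P) \<in> alg_carrier aug"
  using one_closed eps_one by (simp add: aug_iff arity_closed eps_diff eps_scale del: eps.simps One_nat_def)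

lemma alg_derivationD:
  assumes "alg_derivation aug d"
  shows "linear_between (scal P) (alg_carrier aug) (alg_carrier aug) d"
    and "x \<in> alg_carrier aug \<Longrightarrow> d x \<in> alg_carrier aug"
    and "\<lbrakk>x \<in> alg_carrier aug; y \<in> alg_carrier aug\<rbrakk> \<Longrightarrow> d (x + y) = d x + d y"
    and "\<lbrakk>x \<in> alg_carrier aug; y \<in> alg_carrier aug\<rbrakk> \<Longrightarrow> d (x - y) = d x - d y"
    and "x \<in> alg_carrier aug \<Longrightarrow> d (scal P c x) = scal P c (d x)"
    and "\<lbrakk>x \<in> alg_carrier aug; y \<in> alg_carrier aug\<rbrakk> \<Longrightarrow> d (x \<odot> y) = d x \<odot> y + x \<odot> d y"
    and "x \<notin> alg_carrier aug \<Longrightarrow> d x = 0"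
    and "d 0 = 0"
proof -
  show lin: "linear_between (scal P) (alg_carrier aug) (alg_carrier aug) d"
    using assms unfolding alg_derivation_def by simp
  show "d (x - y) = d x - d y" if "x \<in> alg_carrier aug" "y \<in> alg_carrier aug"
    by (rule linear_between_diff[OF vector_space aug_subspace lin that])
  show "d 0 = 0" by (rule linear_between_zero[OF vector_space aug_subspace lin])
qed (use assms in \<open>auto simp: alg_derivation_def linear_between_def\<close>)

lemma alg_derivationI:
  assumes "\<And>x. x \<in> alg_carrier aug \<Longrightarrow> d x \<in> alg_carrier aug"
    and "\<And>x y. \<lbrakk>x \<in> alg_carrier aug; y \<in> alg_carrier aug\<rbrakk> \<Longrightarrow> d (x + y) = d x + d y"
    and "\<And>c x. x \<in> alg_carrier aug \<Longrightarrow> d (scal P c x) = scal P c (d x)"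
    and "\<And>x y. \<lbrakk>x \<in> alg_carrier aug; y \<in> alg_carrier aug\<rbrakk> \<Longrightarrow> d (x \<odot> y) = d x \<odot> y + x \<odot> d y"
    and "\<And>x. x \<notin> alg_carrier aug \<Longrightarrow> d x = 0"
  shows "alg_derivation aug d"
  using assms unfolding alg_derivation_def linear_between_def by simp

lemma lie_algebra_alg_der: "lie_algebra (alg_der aug)"
proof (rule lie_algebra_of_operators[where V = "\<lambda>_::unit. alg_carrier aug" and ev = "\<lambda>d _. d"
      and s = "scal P"])
  show "lzero (alg_der aug) \<in> lcarrier (alg_der aug)"
    by (auto simp: alg_der_def comp_zero_left comp_zero_right aug_arity
        intro!: alg_derivationI aug_closed simp del: One_nat_def)
  fix d e assume "d \<in> lcarrier (alg_der aug)" "e \<in> lcarrier (alg_der aug)"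
  then have d: "alg_derivation aug d" and e: "alg_derivation aug e" by (simp_all add: alg_der_def)
  have "alg_derivation aug (\<lambda>x. d x + e x)"
    by (rule alg_derivationI) (simp_all add: alg_derivationD[OF d] alg_derivationD[OF e] aug_closed aug_arity
        umult_distribs umult_scale umult_closed vs.scale_right_distrib del: One_nat_def)
  then show "ladd (alg_der aug) d e \<in> lcarrier (alg_der aug)"
    by (simp add: alg_der_def)
  have "alg_derivation aug (\<lambda>x. d (e x) - e (d x))"
    by (rule alg_derivationI) (simp_all add: alg_derivationD[OF d] alg_derivationD[OF e] aug_closed aug_arity
        umult_distribs umult_scale umult_closed vs.scale_right_diff_distrib del: One_nat_def)
  then show "lbracket (alg_der aug) d e \<in> lcarrier (alg_der aug)"
    by (simp add: alg_der_def)
next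
  fix c d assume "d \<in> lcarrier (alg_der aug)"
  then have d: "alg_derivation aug d" by (simp add: alg_der_def)
  have "alg_derivation aug (\<lambda>x. scal P c (d x))"
    by (rule alg_derivationI) (simp_all add: alg_derivationD[OF d] aug_closed aug_arity
        umult_distribs umult_scale umult_closed vs.scale_right_distrib vs.scale_left_commute
        del: One_nat_def)
  then show "lsmult (alg_der aug) c d \<in> lcarrier (alg_der aug)"
    by (simp add: alg_der_def)
next
  fix d e assume "d \<in> lcarrier (alg_der aug)" "e \<in> lcarrier (alg_der aug)"
    and "\<And>(i::unit) a. a \<in> alg_carrier aug \<Longrightarrow> d a = e a"
  then show "d = e" by (auto simp: alg_der_def alg_derivation_def fun_eq_iff) metis
qed (use vector_space aug_subspace in \<open>auto simp: alg_der_def alg_derivation_def\<close>)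

text \<open>The extension of a derivation of the augmentation ideal to \<open>P(1)\<close> that kills the identity.\<close>

definition ext_der :: "('a \<Rightarrow> 'a) \<Rightarrow> 'a \<Rightarrow> 'a" where
  "ext_der d x = d (x - scal P (eps 1 x) (pone P))"

context
  fixes d assumes d: "alg_derivation aug d"
begin

lemma ext_der_aug: "x \<in> alg_carrier aug \<Longrightarrow> ext_der d x = d x"
  by (simp add: ext_der_def aug_iff del: eps.simps One_nat_def)

lemma ext_der_closed: "x \<in> arity P 1 \<Longrightarrow> ext_der d x \<in> alg_carrier aug"
  unfolding ext_der_def by (intro alg_derivationD(2)[OF d] aug_part)

lemma ext_der_add:
  assumes "x \<in> arity P 1" "y \<in> arity P 1"
  shows "ext_der d (x + y) = ext_der d x + ext_der d y"
proof -
  have "x + y - scal P (eps 1 (x + y)) (pone P)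
      = (x - scal P (eps 1 x) (pone P)) + (y - scal P (eps 1 y) (pone P))"
    using assms by (simp add: eps_add vs.scale_left_distrib del: eps.simps One_nat_def)
  then show ?thesis
    unfolding ext_der_def using alg_derivationD(3)[OF d] aug_part assms by metis
qed

lemma ext_der_scale:
  assumes "x \<in> arity P 1"
  shows "ext_der d (scal P c x) = scal P c (ext_der d x)"
proof -
  have "scal P c x - scal P (eps 1 (scal P c x)) (pone P)
      = scal P c (x - scal P (eps 1 x) (pone P))"
    using assms by (simp add: eps_scale vs.scale_right_diff_distrib del: eps.simps One_nat_def)
  then show ?thesis
    unfolding ext_der_def using alg_derivationD(5)[OF d] aug_part assms by metis
qed

lemma ext_der_umult:
  assumes x: "x \<in> arity P 1" and y: "y \<in> arity P 1"
  shows "ext_der d (x \<odot> y) = ext_der d x \<odot> y + x \<odot> ext_der d y"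
proof -
  let ?a = "x - scal P (eps 1 x) (pone P)" and ?b = "y - scal P (eps 1 y) (pone P)"
  have a: "?a \<in> alg_carrier aug" and b: "?b \<in> alg_carrier aug" using x y aug_part by auto
  note cl = x y one_closed arity_closed umult_closed aug_arity[OF a] aug_arity[OF b]
    aug_arity[OF alg_derivationD(2)[OF d a]] aug_arity[OF alg_derivationD(2)[OF d b]]
  have "x \<odot> y - scal P (eps 1 (x \<odot> y)) (pone P)
      = ?a \<odot> ?b + scal P (eps 1 x) ?b + scal P (eps 1 y) ?a"
    using cl by (simp add: umult_distribs umult_scale umult_one eps_umult vs.scale_right_diff_distrib
        algebra_simps del: eps.simps One_nat_def)
  then have "ext_der d (x \<odot> y) = d ?a \<odot> ?b + ?a \<odot> d ?b + scal P (eps 1 x) (d ?b) + scal P (eps 1 y) (d ?a)"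
    unfolding ext_der_def using a b
    by (simp only: alg_derivationD[OF d] aug_closed)
  also have "\<dots> = d ?a \<odot> y + x \<odot> d ?b"
    using cl by (simp add: umult_distribs umult_scale umult_one algebra_simps del: eps.simps One_nat_def)
  finally show ?thesis unfolding ext_der_def .
qed

end

section \<open>Restricting derivations of the operad\<close>

lemma operad_derivationD:
  assumes "operad_derivation P D"
  shows "linear_between (scal P) (arity P n) (arity P n) (D n)"
    and "x \<in> arity P n \<Longrightarrow> D n x \<in> arity P n"
    and "\<lbrakk>x \<in> arity P n; y \<in> arity P n\<rbrakk> \<Longrightarrow> D n (x + y) = D n x + D n y"
    and "\<lbrakk>x \<in> arity P n; y \<in> arity P n\<rbrakk> \<Longrightarrow> D n (x - y) = D n x - D n y"
    and "x \<in> arity P n \<Longrightarrow> D n (scal P c x) = scal P c (D n x)"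
    and "\<lbrakk>x \<in> arity P n; \<sigma> permutes {1..n}\<rbrakk> \<Longrightarrow> D n (pact P n x \<sigma>) = pact P n (D n x) \<sigma>"
    and "\<lbrakk>i \<in> {1..m}; \<mu> \<in> arity P m; \<nu> \<in> arity P n\<rbrakk> \<Longrightarrow>
      D (m + n - 1) (pcomp P m n i \<mu> \<nu>) = pcomp P m n i (D m \<mu>) \<nu> + pcomp P m n i \<mu> (D n \<nu>)"
    and "x \<notin> arity P n \<Longrightarrow> D n x = 0"
proof -
  show lin: "linear_between (scal P) (arity P n) (arity P n) (D n)"
    using assms unfolding operad_derivation_def by blast
  show "D n (x - y) = D n x - D n y" if "x \<in> arity P n" "y \<in> arity P n"
    by (rule linear_between_diff[OF vector_space arity_subspace lin that])
qed (use assms in \<open>auto simp: operad_derivation_def linear_between_def\<close>)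

lemma operad_derivationI:
  assumes "\<And>n x. x \<in> arity P n \<Longrightarrow> D n x \<in> arity P n"
    and "\<And>n x y. \<lbrakk>x \<in> arity P n; y \<in> arity P n\<rbrakk> \<Longrightarrow> D n (x + y) = D n x + D n y"
    and "\<And>n c x. x \<in> arity P n \<Longrightarrow> D n (scal P c x) = scal P c (D n x)"
    and "\<And>n x \<sigma>. \<lbrakk>x \<in> arity P n; \<sigma> permutes {1..n}\<rbrakk> \<Longrightarrow> D n (pact P n x \<sigma>) = pact P n (D n x) \<sigma>"
    and "\<And>m n i \<mu> \<nu>. \<lbrakk>i \<in> {1..m}; \<mu> \<in> arity P m; \<nu> \<in> arity P n\<rbrakk> \<Longrightarrow>
      D (m + n - 1) (pcomp P m n i \<mu> \<nu>) = pcomp P m n i (D m \<mu>) \<nu> + pcomp P m n i \<mu> (D n \<nu>)"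
    and "\<And>n x. x \<notin> arity P n \<Longrightarrow> D n x = 0"
  shows "operad_derivation P D"
  using assms unfolding operad_derivation_def linear_between_def by blast

lemma act_closed: "\<lbrakk>x \<in> arity P n; \<sigma> permutes {1..n}\<rbrakk> \<Longrightarrow> pact P n x \<sigma> \<in> arity P n"
  using act_linear unfolding linear_between_def by blast

lemma act_add:
  "\<lbrakk>x \<in> arity P n; y \<in> arity P n; \<sigma> permutes {1..n}\<rbrakk>
    \<Longrightarrow> pact P n (x + y) \<sigma> = pact P n x \<sigma> + pact P n y \<sigma>"
  using act_linear unfolding linear_between_def by blast

lemma act_scale:
  "\<lbrakk>x \<in> arity P n; \<sigma> permutes {1..n}\<rbrakk> \<Longrightarrow> pact P n (scal P c x) \<sigma> = scal P c (pact P n x \<sigma>)"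
  using act_linear unfolding linear_between_def by blast

lemma act_diff:
  "\<lbrakk>x \<in> arity P n; y \<in> arity P n; \<sigma> permutes {1..n}\<rbrakk>
    \<Longrightarrow> pact P n (x - y) \<sigma> = pact P n x \<sigma> - pact P n y \<sigma>"
  using linear_between_diff[OF vector_space arity_subspace act_linear] by blast

lemma act_zero: "\<sigma> permutes {1..n} \<Longrightarrow> pact P n 0 \<sigma> = 0"
  using linear_between_zero[OF vector_space arity_subspace act_linear] by blast

lemma operad_derivation_zero: "operad_derivation P (\<lambda>n x. 0)"
  by (rule operad_derivationI) (simp_all add: arity_closed act_zero comp_zero_left comp_zero_right)

lemma operad_derivation_add:
  assumes D: "operad_derivation P D" and E: "operad_derivation P E"
  shows "operad_derivation P (\<lambda>n x. D n x + E n x)"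
  by (rule operad_derivationI) (simp_all add: operad_derivationD[OF D] operad_derivationD[OF E]
      arity_closed vs.scale_right_distrib act_add comp_add_left comp_add_right del: One_nat_def)

lemma operad_derivation_scale:
  assumes D: "operad_derivation P D"
  shows "operad_derivation P (\<lambda>n x. scal P c (D n x))"
  by (rule operad_derivationI) (simp_all add: operad_derivationD[OF D]
      arity_closed vs.scale_right_distrib vs.scale_left_commute act_scale comp_scale_left
      comp_scale_right del: One_nat_def)

lemma operad_derivation_bracket:
  assumes D: "operad_derivation P D" and E: "operad_derivation P E"
  shows "operad_derivation P (\<lambda>n x. D n (E n x) - E n (D n x))"
proof (rule operad_derivationI, goal_cases)
  case (5 m n i \<mu> \<nu>)
  then have cl: "pcomp P m n i (D m \<mu>) \<nu> \<in> arity P (m + n - 1)" "pcomp P m n i \<mu> (D n \<nu>) \<in> arity P (m + n - 1)"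
    "pcomp P m n i (E m \<mu>) \<nu> \<in> arity P (m + n - 1)" "pcomp P m n i \<mu> (E n \<nu>) \<in> arity P (m + n - 1)"
    using comp_closed operad_derivationD(2)[OF D] operad_derivationD(2)[OF E] by blast+
  have DE: "D m \<mu> \<in> arity P m" "E m \<mu> \<in> arity P m" "D n \<nu> \<in> arity P n" "E n \<nu> \<in> arity P n"
    "D m (E m \<mu>) \<in> arity P m" "E m (D m \<mu>) \<in> arity P m" "D n (E n \<nu>) \<in> arity P n" "E n (D n \<nu>) \<in> arity P n"
    using 5 operad_derivationD(2)[OF D] operad_derivationD(2)[OF E] by blast+
  show ?case
    using 5 cl DE
    by (simp only: operad_derivationD(3,7)[OF D] operad_derivationD(3,7)[OF E] comp_diff_left comp_diff_right)
      simp
qed (simp_all add: operad_derivationD[OF D] operad_derivationD[OF E]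
      arity_closed vs.scale_right_diff_distrib act_diff act_closed
      linear_between_zero[OF vector_space arity_subspace operad_derivationD(1)[OF D]]
      linear_between_zero[OF vector_space arity_subspace operad_derivationD(1)[OF E]])

lemma lie_algebra_operad_der: "lie_algebra (operad_der P)"
proof (rule lie_algebra_of_operators[where V = "arity P" and ev = "\<lambda>d. d" and s = "scal P"])
  fix D E assume "D \<in> lcarrier (operad_der P)" "E \<in> lcarrier (operad_der P)"
    and eq: "\<And>n x. x \<in> arity P n \<Longrightarrow> D n x = E n x"
  then have "operad_derivation P D" "operad_derivation P E" by (simp_all add: operad_der_def)
  then have "D n x = E n x" for n x
    using eq operad_derivationD(8) by metis
  then show "D = E" by blast
qed (auto simp: operad_der_def vector_space arity_subspace operad_derivationD operad_derivation_zero
    operad_derivation_add operad_derivation_scale operad_derivation_bracket)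

text \<open>A derivation acts on the line \<open>P(0)\<close> by a scalar, its weight.\<close>

definition weight :: "(nat \<Rightarrow> 'a \<Rightarrow> 'a) \<Rightarrow> 'k" where
  "weight D = coord (D 0 u0)"

definition unary :: "(nat \<Rightarrow> 'a \<Rightarrow> 'a) \<Rightarrow> 'a \<Rightarrow> 'a" where
  "unary D x = (if x \<in> alg_carrier aug then D 1 x else 0)"

context
  fixes D assumes D: "operad_derivation P D"
begin

lemma derivation_u0: "D 0 u0 = scal P (weight D) u0"
  using scale_coord operad_derivationD(2)[OF D u0_closed] by (simp add: weight_def)

text \<open>The derivation rule for \<open>\<theta> \<circ>\<^sub>i u0\<close>: a derivation commutes with plugging up to its weight, and
  isolating one of \<open>n\<close> inputs plugs the other \<open>n - 1\<close>, whence the factor \<open>1 - n\<close> in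
  \<open>res_derivation\<close>; likewise in \<open>eps_derivation\<close>, where the \<open>1\<close> comes from the derivative of the
  nullary result.\<close>

lemma kill_derivation:
  assumes \<theta>: "\<theta> \<in> arity P n" and i: "i \<in> {1..n}"
  shows "kill n i (D n \<theta>) = D (n - 1) (kill n i \<theta>) - scal P (weight D) (kill n i \<theta>)"
  using operad_derivationD(7)[OF D i \<theta> u0_closed] comp_scale_right[OF i \<theta> u0_closed]
  unfolding kill_def derivation_u0 by simp

lemma derivation_one: "D 1 (pone P) = 0"
  using operad_derivationD(7)[OF D _ one_closed one_closed, of 1]
    umult_one[OF operad_derivationD(2)[OF D one_closed]] umult_one(1)[OF one_closed]
  by simp

lemma eps_derivation:
  "\<theta> \<in> arity P n \<Longrightarrow> eps n (D n \<theta>) = weight D * (1 - of_nat n) * eps n \<theta>"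
proof (induction n arbitrary: \<theta>)
  case 0
  then have "D 0 \<theta> = scal P (coord \<theta>) (D 0 u0)"
    using operad_derivationD(5)[OF D u0_closed] scale_coord by metis
  then show ?case using operad_derivationD(2)[OF D u0_closed] by (simp add: coord_scale weight_def)
next
  case (Suc n)
  have k: "kill (Suc n) 1 \<theta> \<in> arity P n" using kill_closed[OF Suc.prems, of 1] by simp
  have "eps (Suc n) (D (Suc n) \<theta>) = eps n (kill (Suc n) 1 (D (Suc n) \<theta>))" by simp
  also have "\<dots> = eps n (D n (kill (Suc n) 1 \<theta>)) - weight D * eps n (kill (Suc n) 1 \<theta>)"
    using kill_derivation[OF Suc.prems, of 1] k
    by (simp add: eps_diff eps_scale operad_derivationD(2)[OF D] arity_closed)
  also have "\<dots> = weight D * (1 - of_nat (Suc n)) * eps n (kill (Suc n) 1 \<theta>)"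
    unfolding Suc.IH[OF k] by (simp add: algebra_simps)
  finally show ?case by simp
qed

lemma res_derivation:
  "\<lbrakk>\<theta> \<in> arity P n; k \<in> {1..n}\<rbrakk>
    \<Longrightarrow> res n k (D n \<theta>) = D 1 (res n k \<theta>) + scal P (weight D * (1 - of_nat n)) (res n k \<theta>)"
proof (induction n k \<theta> rule: res.induct)
  case (3 n k \<theta>)
  \<comment> \<open>The input that the recursion for \<open>res\<close> plugs first, and the position of \<open>k\<close> afterwards.\<close>
  define i where "i = (if k = Suc (Suc n) then 1 else Suc (Suc n))"
  define k' where "k' = (if k = Suc (Suc n) then Suc n else k)"
  have i: "i \<in> {1..Suc (Suc n)}" and k': "k' \<in> {1..Suc n}"
    using 3(4) by (auto simp: i_def k'_def)
  have cl: "kill (Suc (Suc n)) i \<theta> \<in> arity P (Suc n)" using kill_closed[OF 3(3) i] by simp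
  have IH: "res (Suc n) k' (D (Suc n) (kill (Suc (Suc n)) i \<theta>))
      = D 1 (res (Suc n) k' (kill (Suc (Suc n)) i \<theta>))
        + scal P (weight D * (1 - of_nat (Suc n))) (res (Suc n) k' (kill (Suc (Suc n)) i \<theta>))"
    using 3(1,2) cl k' by (auto simp: i_def k'_def)
  have unfold: "res (Suc (Suc n)) k \<phi> = res (Suc n) k' (kill (Suc (Suc n)) i \<phi>)" for \<phi>
    by (simp add: i_def k'_def)
  have "res (Suc (Suc n)) k (D (Suc (Suc n)) \<theta>)
      = res (Suc n) k' (D (Suc n) (kill (Suc (Suc n)) i \<theta>) - scal P (weight D) (kill (Suc (Suc n)) i \<theta>))"
    unfolding unfold kill_derivation[OF 3(3) i] by simp
  also have "\<dots> = res (Suc n) k' (D (Suc n) (kill (Suc (Suc n)) i \<theta>))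
      - scal P (weight D) (res (Suc n) k' (kill (Suc (Suc n)) i \<theta>))"
    using cl k' by (simp add: res_diff res_scale operad_derivationD(2)[OF D] arity_closed del: res.simps)
  finally show ?case
    unfolding IH unfold by (simp add: algebra_simps vs.scale_left_distrib vs.scale_left_diff_distrib del: res.simps)
qed auto

lemma alg_derivation_unary: "alg_derivation aug (unary D)"
proof (rule alg_derivationI)
  fix x assume x: "x \<in> alg_carrier aug"
  then show "unary D x \<in> alg_carrier aug"
    using eps_derivation[of x 1] operad_derivationD(2)[OF D, of x 1]
    by (simp add: unary_def aug_iff del: eps.simps)
  fix y assume y: "y \<in> alg_carrier aug"
  show "unary D (x \<odot> y) = unary D x \<odot> y + x \<odot> unary D y"
    using operad_derivationD(7)[OF D _ aug_arity[OF x] aug_arity[OF y], of 1] x y aug_closed(5)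
    by (simp add: unary_def)
qed (simp_all add: unary_def aug_closed operad_derivationD[OF D] aug_arity del: One_nat_def)

lemma ext_der_unary: "x \<in> arity P 1 \<Longrightarrow> ext_der (unary D) x = D 1 x"
  using aug_part[of x] derivation_one operad_derivationD(4,5)[OF D] one_closed
  by (simp add: ext_der_def unary_def arity_closed del: eps.simps One_nat_def)

end

end

section \<open>Extending derivations to the operad\<close>

text \<open>Operads in which an operation with at least two inputs is determined by the results of plugging
  single inputs. By \<open>kill_jointly_injective\<close> these include the operads of Gelfand-Kirillov
  dimension two.\<close>

locale coordinate_operad = two_unitary_operad P u0
  for P :: "('k::field, 'a::ab_group_add) operad_data" and u0 :: 'a +
  assumes kill_injective:
    "\<lbrakk>m \<ge> 2; \<theta> \<in> arity P m; \<And>i. i \<in> {1..m} \<Longrightarrow> kill m i \<theta> = 0\<rbrakk> \<Longrightarrow> \<theta> = 0"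
begin

text \<open>The coordinates of \<open>kill n i \<theta>\<close> are coordinates of \<open>\<theta>\<close>, so if these vanish then by induction
  \<open>\<theta>\<close> is killed by plugging any input.\<close>

lemma res_eq_zeroD:
  "\<lbrakk>n > 0; \<theta> \<in> arity P n; \<And>j. j \<in> {1..n} \<Longrightarrow> res n j \<theta> = 0\<rbrakk> \<Longrightarrow> \<theta> = 0"
proof (induction n arbitrary: \<theta>)
  case (Suc n)
  show ?case
  proof (cases "n = 0")
    case True
    then show ?thesis using Suc.prems(3)[of 1] by simp
  next
    case False
    show ?thesis
    proof (rule kill_injective[OF _ Suc.prems(2)])
      fix i assume i: "i \<in> {1..Suc n}"
      show "kill (Suc n) i \<theta> = 0"
      proof (rule Suc.IH)
        show "kill (Suc n) i \<theta> \<in> arity P n" using kill_closed[OF Suc.prems(2) i] by simp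
        fix j assume j: "j \<in> {1..n}"
        define j' where "j' = (if j < i then j else Suc j)"
        have j': "j' \<in> {1..Suc n}" "i \<noteq> j'" "(if i < j' then j' - 1 else j') = j"
          using j by (auto simp: j'_def)
        show "res n j (kill (Suc n) i \<theta>) = 0"
          using res_kill[OF Suc.prems(2) i j'(1,2)] Suc.prems(3)[OF j'(1)] unfolding j'(3) by simp
      qed (use False in simp)
    qed (use False in simp)
  qed
qed simp

text \<open>In positive arity the coordinates \<open>res n j\<close> suffice; in arity \<open>0\<close> there are none and \<open>eps 0\<close> is
  the coordinate on the line.\<close>

lemma coordinates_injective:
  assumes \<theta>: "\<theta> \<in> arity P n" and \<theta>': "\<theta>' \<in> arity P n"
    and eps: "eps n \<theta> = eps n \<theta>'"
    and res: "\<And>j. j \<in> {1..n} \<Longrightarrow> res n j \<theta> = res n j \<theta>'"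
  shows "\<theta> = \<theta>'"
proof (cases "n = 0")
  case True
  then show ?thesis using \<theta> \<theta>' eps scale_coord by (metis eps.simps(1))
next
  case False
  have "res n j (\<theta> - \<theta>') = 0" if "j \<in> {1..n}" for j
    using res_diff[OF \<theta> \<theta>' that] res[OF that] by simp
  with False have "\<theta> - \<theta>' = 0"
    by (intro res_eq_zeroD[OF _ arity_closed(3)[OF \<theta> \<theta>']]) simp_all
  then show ?thesis by simp
qed

text \<open>The derivation of weight \<open>c\<close> that restricts to \<open>d\<close>. The formula is dictated by
  \<open>res_derivation\<close>: the sum applies \<open>d\<close> in each coordinate, and the last term is the inner
  derivation of \<open>c\<close> times the identity, which is scaling by \<open>c * (1 - n)\<close> in arity \<open>n\<close>.\<close>

definition extend :: "'k \<Rightarrow> ('a \<Rightarrow> 'a) \<Rightarrow> nat \<Rightarrow> 'a \<Rightarrow> 'a" where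
  "extend c d n \<theta> = (if \<theta> \<in> arity P n
     then (\<Sum>j = 1..n. pcomp P n 1 j (unit_of n) (ext_der d (res n j \<theta>))) + scal P (c * (1 - of_nat n)) \<theta>
     else 0)"

context
  fixes d assumes d: "alg_derivation aug d"
begin

lemma ext_der_res:
  assumes "\<theta> \<in> arity P n" "j \<in> {1..n}"
  shows "ext_der d (res n j \<theta>) \<in> arity P 1" "eps 1 (ext_der d (res n j \<theta>)) = 0"
    "pcomp P n 1 j (unit_of n) (ext_der d (res n j \<theta>)) \<in> arity P n"
proof -
  have "ext_der d (res n j \<theta>) \<in> alg_carrier aug"
    using ext_der_closed[OF d] res_closed[OF assms] by blast
  then show "ext_der d (res n j \<theta>) \<in> arity P 1" "eps 1 (ext_der d (res n j \<theta>)) = 0"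
    by (simp_all add: aug_iff del: eps.simps)
  then show "pcomp P n 1 j (unit_of n) (ext_der d (res n j \<theta>)) \<in> arity P n"
    using comp_closed[OF assms(2) unit_of_closed, of _ 1] by simp
qed

lemma extend_closed:
  assumes \<theta>: "\<theta> \<in> arity P n"
  shows "extend c d n \<theta> \<in> arity P n"
proof -
  have "(\<Sum>j = 1..n. pcomp P n 1 j (unit_of n) (ext_der d (res n j \<theta>))) \<in> arity P n"
    using ext_der_res(3)[OF \<theta>] by (intro arity_sum)
  then show ?thesis using \<theta> by (simp add: extend_def arity_closed del: One_nat_def)
qed

lemma res_extend:
  assumes \<theta>: "\<theta> \<in> arity P n" and k: "k \<in> {1..n}"
  shows "res n k (extend c d n \<theta>) = ext_der d (res n k \<theta>) + scal P (c * (1 - of_nat n)) (res n k \<theta>)"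
proof -
  let ?t = "\<lambda>j. pcomp P n 1 j (unit_of n) (ext_der d (res n j \<theta>))"
  have "res n k (\<Sum>j = 1..n. ?t j) = (\<Sum>j = 1..n. res n k (?t j))"
    using ext_der_res(3)[OF \<theta>] by (intro linear_between_sum[OF vector_space arity_subspace res_linear[OF k]])
  also have "\<dots> = (\<Sum>j = 1..n. if k = j then ext_der d (res n j \<theta>) else 0)"
    using res_insert_aug[OF ext_der_res(1,2)[OF \<theta>] _ k] by (intro sum.cong) auto
  also have "\<dots> = ext_der d (res n k \<theta>)"
    using k by simp
  finally have sum: "res n k (\<Sum>j = 1..n. ?t j) = ext_der d (res n k \<theta>)" .
  have "(\<Sum>j = 1..n. ?t j) \<in> arity P n"
    using ext_der_res(3)[OF \<theta>] by (intro arity_sum)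
  then show ?thesis
    using \<theta> sum k by (simp add: extend_def res_add res_scale arity_closed del: res.simps One_nat_def)
qed

lemma eps_extend:
  assumes \<theta>: "\<theta> \<in> arity P n"
  shows "eps n (extend c d n \<theta>) = c * (1 - of_nat n) * eps n \<theta>"
proof (cases "n = 0")
  case True
  then show ?thesis using \<theta> by (simp add: extend_def coord_scale)
next
  case False
  then have 1: "1 \<in> {1..n}" by simp
  have r: "res n 1 \<theta> \<in> arity P 1" by (rule res_closed[OF \<theta> 1])
  have "eps n (extend c d n \<theta>) = eps 1 (res n 1 (extend c d n \<theta>))"
    using eps_res[OF extend_closed[OF \<theta>] 1] by simp
  also have "\<dots> = c * (1 - of_nat n) * eps 1 (res n 1 \<theta>)"
    unfolding res_extend[OF \<theta> 1] using ext_der_res[OF \<theta> 1] r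
    by (simp add: eps_add eps_scale arity_closed del: eps.simps One_nat_def)
  also have "eps 1 (res n 1 \<theta>) = eps n \<theta>" by (rule eps_res[OF \<theta> 1])
  finally show ?thesis .
qed

text \<open>All identities are compared in coordinates. For a composite the inputs inside the block of \<open>\<nu>\<close>
  reduce to the derivation rule of \<open>ext_der d\<close> on \<open>P(1)\<close>, and the inputs outside to its linearity
  together with the effect of \<open>extend\<close> on \<open>eps\<close>. The weights match because
  \<open>1 - (m + n - 1) = (1 - m) + (1 - n)\<close>.\<close>

lemma operad_derivation_extend: "operad_derivation P (extend c d)"
proof (rule operad_derivationI)
  fix n x assume x: "x \<in> arity P n"
  then show "extend c d n x \<in> arity P n" by (rule extend_closed)
  note simps = arity_closed extend_closed eps_extend res_extend eps_add eps_scale res_add res_scale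
    res_closed ext_der_add[OF d] ext_der_scale[OF d] ext_der_res(1)
  show "extend c d n (scal P b x) = scal P b (extend c d n x)" for b
    by (rule coordinates_injective[of _ n])
      (simp_all add: x simps vs.scale_right_distrib mult_ac del: eps.simps res.simps One_nat_def)
  show "extend c d n (x + y) = extend c d n x + extend c d n y" if y: "y \<in> arity P n" for y
    by (rule coordinates_injective[of _ n])
      (simp_all add: x y simps vs.scale_right_distrib distrib_left del: eps.simps res.simps One_nat_def)
  show "extend c d n (pact P n x \<sigma>) = pact P n (extend c d n x) \<sigma>" if \<sigma>: "\<sigma> permutes {1..n}" for \<sigma>
  proof (rule coordinates_injective[of _ n])
    show cl: "extend c d n (pact P n x \<sigma>) \<in> arity P n" "pact P n (extend c d n x) \<sigma> \<in> arity P n"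
      using x \<sigma> by (simp_all add: act_closed extend_closed)
    show res: "res n j (extend c d n (pact P n x \<sigma>)) = res n j (pact P n (extend c d n x) \<sigma>)"
      if j: "j \<in> {1..n}" for j
      using j permutes_in_image[OF \<sigma>, of j]
      by (simp add: x \<sigma> act_closed extend_closed res_extend res_act del: One_nat_def)
    show "eps n (extend c d n (pact P n x \<sigma>)) = eps n (pact P n (extend c d n x) \<sigma>)"
    proof (cases "n = 0")
      case True
      then have "\<sigma> = id" using \<sigma> by simp
      then show ?thesis using x by (simp add: act_id extend_closed)
    next
      case False
      then show ?thesis using eps_res[OF cl(1), of 1] eps_res[OF cl(2), of 1] res[of 1] by simp
    qed
  qed
next
  fix m n i \<mu> \<nu> assume i: "i \<in> {1..m}" and \<mu>: "\<mu> \<in> arity P m" and \<nu>: "\<nu> \<in> arity P n"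
  let ?E = "extend c d"
  have cl: "pcomp P m n i \<mu> \<nu> \<in> arity P (m + n - 1)" "pcomp P m n i (?E m \<mu>) \<nu> \<in> arity P (m + n - 1)"
    "pcomp P m n i \<mu> (?E n \<nu>) \<in> arity P (m + n - 1)" and E: "?E m \<mu> \<in> arity P m" "?E n \<nu> \<in> arity P n"
    using i \<mu> \<nu> by (simp_all add: comp_closed extend_closed del: One_nat_def)
  have "m + n \<ge> 1" using i by auto
  then have of_nat: "(of_nat (m + n - 1) :: 'k) = of_nat m + of_nat n - 1"
    by (simp add: of_nat_diff)
  have weights: "scal P (c * (1 - (of_nat m + of_nat n - 1))) y
      = scal P (c * (1 - of_nat m)) y + scal P (c * (1 - of_nat n)) y" for y
    unfolding vs.scale_left_distrib[symmetric] by (simp add: algebra_simps)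
  show "?E (m + n - 1) (pcomp P m n i \<mu> \<nu>) = pcomp P m n i (?E m \<mu>) \<nu> + pcomp P m n i \<mu> (?E n \<nu>)"
  proof (rule coordinates_injective[of _ "m + n - 1"])
    show "eps (m + n - 1) (?E (m + n - 1) (pcomp P m n i \<mu> \<nu>))
        = eps (m + n - 1) (pcomp P m n i (?E m \<mu>) \<nu> + pcomp P m n i \<mu> (?E n \<nu>))"
      unfolding eps_extend[OF cl(1)] eps_add[OF cl(2,3)] eps_comp[OF \<mu> \<nu> i] eps_comp[OF E(1) \<nu> i]
        eps_comp[OF \<mu> E(2) i] eps_extend[OF \<mu>] eps_extend[OF \<nu>] of_nat
      by (simp add: algebra_simps)
    fix k assume k: "k \<in> {1..m + n - 1}"
    consider (left) "k < i" | (inside) j where "j \<in> {1..n}" "k = i - 1 + j"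
      | (right) p where "i < p" "p \<le> m" "k = p - 1 + n"
    proof -
      have "k < i \<or> (k - (i - 1) \<in> {1..n} \<and> k = i - 1 + (k - (i - 1)))
          \<or> (i < k + 1 - n \<and> k + 1 - n \<le> m \<and> k = (k + 1 - n) - 1 + n)"
        using k i by auto
      then show thesis using that by blast
    qed
    then show "res (m + n - 1) k (?E (m + n - 1) (pcomp P m n i \<mu> \<nu>))
        = res (m + n - 1) k (pcomp P m n i (?E m \<mu>) \<nu> + pcomp P m n i \<mu> (?E n \<nu>))"
    proof cases
      case left
      have k': "k \<in> {1..m}" "i \<le> m" "1 \<le> k" using left i k by auto
      note res_k = res_comp_left[OF _ _ k'(2,3) left]
      show ?thesis
        unfolding res_extend[OF cl(1) k] res_add[OF cl(2,3) k] res_k[OF \<mu> \<nu>] res_k[OF E(1) \<nu>]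
          res_k[OF \<mu> E(2)] eps_extend[OF \<nu>] res_extend[OF \<mu> k'(1)] of_nat weights
          ext_der_scale[OF d res_closed[OF \<mu> k'(1)]]
        by (simp add: vs.scale_right_distrib mult_ac add_ac)
    next
      case right
      have p: "p \<in> {1..m}" "1 \<le> i" using right i by auto
      note res_k = res_comp_right[where n = n, OF _ _ p(2) right(1,2), folded right(3)]
      show ?thesis
        unfolding res_extend[OF cl(1) k] res_add[OF cl(2,3) k] res_k[OF \<mu> \<nu>] res_k[OF E(1) \<nu>]
          res_k[OF \<mu> E(2)] eps_extend[OF \<nu>] res_extend[OF \<mu> p(1)] of_nat weights
          ext_der_scale[OF d res_closed[OF \<mu> p(1)]]
        by (simp add: vs.scale_right_distrib mult_ac add_ac)
    next
      case inside
      note res_k = res_comp_inside[OF _ _ i inside(1), folded inside(2)]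
      have r: "res m i \<mu> \<in> arity P 1" "res n j \<nu> \<in> arity P 1"
        using res_closed \<mu> \<nu> i inside(1) by blast+
      note e = ext_der_res(1)[OF \<mu> i] ext_der_res(1)[OF \<nu> inside(1)]
      show ?thesis
        unfolding res_extend[OF cl(1) k] res_add[OF cl(2,3) k] res_k[OF \<mu> \<nu>] res_k[OF E(1) \<nu>]
          res_k[OF \<mu> E(2)] res_extend[OF \<mu> i] res_extend[OF \<nu> inside(1)] of_nat weights
          ext_der_umult[OF d r]
        using r e by (simp add: umult_distribs umult_scale arity_closed add_ac del: One_nat_def)
    qed
  qed (use cl in \<open>simp_all add: extend_closed arity_closed del: One_nat_def\<close>)
qed (simp add: extend_def)

lemma weight_extend: "weight (extend c d) = c"
  using u0_closed by (simp add: weight_def extend_def)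

lemma unary_extend: "unary (extend c d) = d"
proof
  fix x
  show "unary (extend c d) x = d x"
    using res_extend[of x 1 1 c] ext_der_aug[OF d, of x] alg_derivationD(7)[OF d, of x] aug_arity[of x]
    by (simp add: unary_def)
qed

end

text \<open>By \<open>res_derivation\<close> and \<open>eps_derivation\<close> the coordinates of \<open>D n x\<close> are computed from those of \<open>x\<close>
  by the action of \<open>D\<close> on \<open>P(1)\<close> and the weight alone.\<close>

lemma derivation_eqI:
  assumes D: "operad_derivation P D" and E: "operad_derivation P E"
    and weight: "weight D = weight E" and unary: "unary D = unary E"
  shows "D = E"
proof (intro ext)
  fix n x
  show "D n x = E n x"
  proof (cases "x \<in> arity P n")
    case True
    show ?thesis
    proof (rule coordinates_injective)
      show "eps n (D n x) = eps n (E n x)"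
        using True by (simp add: eps_derivation[OF D] eps_derivation[OF E] weight)
      show "res n j (D n x) = res n j (E n x)" if j: "j \<in> {1..n}" for j
        using ext_der_unary[OF D res_closed[OF True j]] ext_der_unary[OF E res_closed[OF True j]]
        by (simp add: res_derivation[OF D True j] res_derivation[OF E True j] weight unary)
    qed (use True in \<open>simp_all add: operad_derivationD(2)[OF D] operad_derivationD(2)[OF E]\<close>)
  qed (simp add: operad_derivationD(8)[OF D] operad_derivationD(8)[OF E])
qed

lemma derivation_eq_extend:
  assumes D: "operad_derivation P D"
  shows "D = extend (weight D) (unary D)"
  using alg_derivation_unary[OF D]
  by (intro derivation_eqI) (simp_all add: D operad_derivation_extend weight_extend unary_extend)

section \<open>Inner derivations\<close>

lemma alg_derivation_ad:
  assumes b: "b \<in> alg_carrier aug"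
  shows "alg_derivation aug (alg_ad aug b)"
proof (rule alg_derivationI)
  fix x y assume x: "x \<in> alg_carrier aug" and y: "y \<in> alg_carrier aug"
  note [simp] = x y b aug_closed aug_arity umult_closed umult_distribs umult_scale
  show "alg_ad aug b (x \<odot> y) = alg_ad aug b x \<odot> y + x \<odot> alg_ad aug b y"
    by (simp add: alg_ad_def umult_assoc del: One_nat_def)
  show "alg_ad aug b (x + y) = alg_ad aug b x + alg_ad aug b y"
    by (simp add: alg_ad_def del: One_nat_def)
qed (simp_all add: alg_ad_def b aug_closed aug_arity umult_distribs umult_scale vs.scale_right_diff_distrib del: One_nat_def)

text \<open>In coordinates, \<open>\<theta> \<circ>\<^sub>i u\<close> multiplies the \<open>i\<close>-th coordinate of \<open>\<theta>\<close> by \<open>u\<close> and the others by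
  the scalar \<open>eps 1 u\<close>; hence inner derivations are inner in each coordinate, up to weight.\<close>

lemma operad_ad_eq_extend:
  assumes u: "u \<in> arity P 1"
  shows "operad_ad P u = extend (eps 1 u) (alg_ad aug (u - scal P (eps 1 u) (pone P)))"
proof (intro ext)
  fix n \<theta>
  let ?c = "eps 1 u" and ?b = "u - scal P (eps 1 u) (pone P)"
  let ?d = "alg_ad aug ?b"
  have b: "?b \<in> alg_carrier aug" by (rule aug_part[OF u])
  have d: "alg_derivation aug ?d" by (rule alg_derivation_ad[OF b])
  show "operad_ad P u n \<theta> = extend ?c ?d n \<theta>"
  proof (cases "\<theta> \<in> arity P n")
    case \<theta>: True
    have outer: "pcomp P 1 n 1 u \<theta> \<in> arity P n"
      using comp_closed[OF _ u \<theta>, of 1] by simp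
    have inner: "pcomp P n 1 i \<theta> u \<in> arity P n" if "i \<in> {1..n}" for i
      using comp_closed[OF that \<theta> u] by simp
    have sum: "(\<Sum>i = 1..n. pcomp P n 1 i \<theta> u) \<in> arity P n"
      using inner by (intro arity_sum)
    have ad: "operad_ad P u n \<theta> = pcomp P 1 n 1 u \<theta> - (\<Sum>i = 1..n. pcomp P n 1 i \<theta> u)"
      using \<theta> by (simp add: operad_ad_def)
    have ad_closed: "operad_ad P u n \<theta> \<in> arity P n"
      unfolding ad using outer sum by (rule arity_closed(3))
    have res: "res n k (operad_ad P u n \<theta>) = res n k (extend ?c ?d n \<theta>)" if k: "k \<in> {1..n}" for k
    proof -
      let ?x = "res n k \<theta>"
      have x: "?x \<in> arity P 1" by (rule res_closed[OF \<theta> k])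
      have "res n k (pcomp P n 1 i \<theta> u) = (if i = k then ?x \<odot> u - scal P ?c ?x else 0) + scal P ?c ?x"
        if i: "i \<in> {1..n}" for i
      proof -
        consider "i = k" | "k < i" | "i < k" by linarith
        then show ?thesis
          using res_comp_inside[OF \<theta> u i, of 1] res_comp_left[OF \<theta> u, of i k]
            res_comp_right[OF \<theta> u, of i k] i k
          by cases (simp_all del: eps.simps)
      qed
      then have "res n k (\<Sum>i = 1..n. pcomp P n 1 i \<theta> u)
          = (\<Sum>i = 1..n. (if i = k then ?x \<odot> u - scal P ?c ?x else 0) + scal P ?c ?x)"
        using inner by (subst linear_between_sum[OF vector_space arity_subspace res_linear[OF k]]) auto
      also have "\<dots> = ?x \<odot> u - scal P ?c ?x + scal P (of_nat n * ?c) ?x"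
      proof -
        have "(\<Sum>i = 1..n. scal P ?c ?x) = scal P (of_nat n * ?c) ?x"
          by (simp only: vs.scale_sum_left[symmetric] sum_constant card_atLeastAtMost diff_Suc_Suc
              Suc_eq_plus1[symmetric] One_nat_def diff_zero)
        then show ?thesis using k by (simp add: sum.distrib del: eps.simps)
      qed
      finally have A: "res n k (operad_ad P u n \<theta>)
          = u \<odot> ?x - (?x \<odot> u - scal P ?c ?x + scal P (of_nat n * ?c) ?x)"
        unfolding ad res_diff[OF outer sum k]
        using res_comp_inside[OF u \<theta> _ k, of 1] by simp
      have B: "ext_der ?d ?x = u \<odot> ?x - ?x \<odot> u"
        using aug_part[OF x] x u one_closed
        by (simp add: ext_der_def alg_ad_def umult_distribs umult_scale umult_one umult_closed arity_closed
            vs.scale_right_diff_distrib mult.commute del: eps.simps One_nat_def)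
      have "scal P (?c * (1 - of_nat n)) ?x = scal P ?c ?x - scal P (of_nat n * ?c) ?x"
        unfolding vs.scale_left_diff_distrib[symmetric] by (simp add: algebra_simps)
      then show ?thesis
        unfolding res_extend[OF d \<theta> k] A B by simp
    qed
    show ?thesis
    proof (rule coordinates_injective[OF ad_closed extend_closed[OF d \<theta>] _ res])
      show "eps n (operad_ad P u n \<theta>) = eps n (extend ?c ?d n \<theta>)"
      proof (cases "n = 0")
        case True
        then show ?thesis
          using eps_comp[OF u \<theta>, of 1] eps_extend[OF d \<theta>, of ?c] ad by simp
      next
        case False
        then have 1: "1 \<in> {1..n}" by simp
        show ?thesis
          using eps_res[OF ad_closed 1] eps_res[OF extend_closed[OF d \<theta>] 1] res[OF 1] by metis
      qed
    qed
  qed (simp add: operad_ad_def extend_def)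
qed

text \<open>If \<open>D\<close> restricts to the commutator with \<open>b\<close>, its weight can be matched as well by adding a
  multiple of the identity to \<open>b\<close>, because the identity commutes with all of \<open>P(1)\<close>.\<close>

lemma operad_ider_iff:
  "operad_ider P = {D \<in> lcarrier (operad_der P). unary D \<in> alg_ider aug}"
proof (intro equalityI subsetI)
  fix D assume "D \<in> operad_ider P"
  then obtain u where u: "u \<in> arity P 1" "D = operad_ad P u" by (auto simp: operad_ider_def)
  let ?b = "u - scal P (eps 1 u) (pone P)"
  have b: "?b \<in> alg_carrier aug" by (rule aug_part[OF u(1)])
  note d = alg_derivation_ad[OF b]
  show "D \<in> {D \<in> lcarrier (operad_der P). unary D \<in> alg_ider aug}"
    using operad_derivation_extend[OF d] unary_extend[OF d] b
    by (auto simp: u(2) operad_ad_eq_extend[OF u(1)] operad_der_def alg_ider_def)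
next
  fix D assume "D \<in> {D \<in> lcarrier (operad_der P). unary D \<in> alg_ider aug}"
  then obtain b where D: "operad_derivation P D" and b: "b \<in> alg_carrier aug" "unary D = alg_ad aug b"
    by (auto simp: operad_der_def alg_ider_def)
  let ?u = "b + scal P (weight D) (pone P)"
  have u: "?u \<in> arity P 1" using aug_arity[OF b(1)] one_closed by (simp add: arity_closed)
  have "eps 1 ?u = weight D"
    using b(1) one_closed eps_one
    by (simp add: aug_iff eps_add eps_scale arity_closed del: eps.simps One_nat_def)
  then have "operad_ad P ?u = D"
    using operad_ad_eq_extend[OF u] derivation_eq_extend[OF D] b(2) by simp
  then show "D \<in> operad_ider P" unfolding operad_ider_def using u by (metis imageI)
qed

lemma lie_ideal_alg_ider: "lie_ideal (alg_der aug) (alg_ider aug)"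
proof -
  have add: "alg_ad aug (a + b) = (\<lambda>x. alg_ad aug a x + alg_ad aug b x)"
    if "a \<in> alg_carrier aug" "b \<in> alg_carrier aug" for a b
    using that by (auto simp: alg_ad_def fun_eq_iff umult_distribs aug_arity simp del: One_nat_def)
  have scale: "alg_ad aug (scal P c a) = (\<lambda>x. scal P c (alg_ad aug a x))"
    if "a \<in> alg_carrier aug" for a c
    using that by (auto simp: alg_ad_def fun_eq_iff umult_scale aug_arity vs.scale_right_diff_distrib
        simp del: One_nat_def)
  have zero: "alg_ad aug 0 = (\<lambda>x. 0)"
    by (auto simp: alg_ad_def fun_eq_iff comp_zero_left comp_zero_right aug_arity simp del: One_nat_def)
  have bracket: "(\<lambda>x. d (alg_ad aug b x) - alg_ad aug b (d x)) = alg_ad aug (d b)"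
    if d: "alg_derivation aug d" and b: "b \<in> alg_carrier aug" for d b
  proof
    fix x
    show "d (alg_ad aug b x) - alg_ad aug b (d x) = alg_ad aug (d b) x"
    proof (cases "x \<in> alg_carrier aug")
      case True
      then show ?thesis
        using b alg_derivationD(2)[OF d] by (simp add: alg_ad_def alg_derivationD(4,6)[OF d] aug_closed
            del: One_nat_def)
    next
      case False
      then show ?thesis
        using alg_derivationD(7,8)[OF d] aug_closed(1) zero b
        by (simp add: alg_ad_def comp_zero_left comp_zero_right aug_arity del: One_nat_def)
    qed
  qed
  show ?thesis
    unfolding lie_ideal_def alg_ider_def
  proof (intro conjI ballI allI, goal_cases)
    case 1
    then show ?case using alg_derivation_ad by (auto simp: alg_der_def)
  next
    case 2
    then show ?case using imageI[OF aug_closed(1), of "alg_ad aug"] by (simp add: alg_der_def zero)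
  next
    case (3 d e)
    then obtain a b where ab: "a \<in> alg_carrier aug" "b \<in> alg_carrier aug"
      and "d = alg_ad aug a" "e = alg_ad aug b" by blast
    then have "ladd (alg_der aug) d e = alg_ad aug (a + b)" using add by (simp add: alg_der_def)
    then show ?case using aug_closed(2)[OF ab] by (metis imageI)
  next
    case (4 d c)
    then obtain a where a: "a \<in> alg_carrier aug" and "d = alg_ad aug a" by blast
    then have "lsmult (alg_der aug) c d = alg_ad aug (scal P c a)" using scale by (simp add: alg_der_def)
    then show ?case using aug_closed(4)[OF a] by (metis imageI)
  next
    case (5 d e)
    then obtain b where d: "alg_derivation aug d" and b: "b \<in> alg_carrier aug"
      and "e = alg_ad aug b" by (auto simp: alg_der_def)
    then have "lbracket (alg_der aug) d e = alg_ad aug (d b)"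
      using bracket[OF d b] by (simp add: alg_der_def)
    then show ?case using alg_derivationD(2)[OF d b] by (metis imageI)
  qed
qed

section \<open>The Lie algebra of derivations\<close>

lemma alg_der_eq_unary: "lcarrier (alg_der aug) = unary ` lcarrier (operad_der P)"
proof (intro equalityI subsetI)
  fix d assume "d \<in> lcarrier (alg_der aug)"
  then have d: "alg_derivation aug d" by (simp add: alg_der_def)
  then show "d \<in> unary ` lcarrier (operad_der P)"
    using unary_extend[OF d, of 0] operad_derivation_extend[OF d, of 0]
    by (intro image_eqI[of _ _ "extend 0 d"]) (simp_all add: operad_der_def)
qed (auto simp: operad_der_def alg_der_def alg_derivation_unary)

lemma unary_bracket:
  assumes D: "operad_derivation P D" and E: "operad_derivation P E"
  shows "unary (\<lambda>n x. D n (E n x) - E n (D n x)) = (\<lambda>x. unary D (unary E x) - unary E (unary D x))"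
proof
  fix x
  show "unary (\<lambda>n x. D n (E n x) - E n (D n x)) x = unary D (unary E x) - unary E (unary D x)"
    using alg_derivationD(2)[OF alg_derivation_unary[OF D], of x]
      alg_derivationD(2)[OF alg_derivation_unary[OF E], of x]
      alg_derivationD(8)[OF alg_derivation_unary[OF D]]
      alg_derivationD(8)[OF alg_derivation_unary[OF E]]
    by (cases "x \<in> alg_carrier aug") (simp_all add: unary_def)
qed

lemma weight_bracket:
  assumes D: "operad_derivation P D" and E: "operad_derivation P E"
  shows "weight (\<lambda>n x. D n (E n x) - E n (D n x)) = 0"
proof -
  have "D 0 (E 0 u0) = scal P (weight E * weight D) u0" "E 0 (D 0 u0) = scal P (weight D * weight E) u0"
    by (simp_all only: derivation_u0[OF D] derivation_u0[OF E] vs.scale_scale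
        operad_derivationD(5)[OF D u0_closed] operad_derivationD(5)[OF E u0_closed])
  then show ?thesis using coord_scale_u0[of 0] by (simp add: weight_def mult.commute del: coord_scale_u0)
qed

lemma unary_hom: "lie_hom (operad_der P) (alg_der aug) unary"
  by (rule lie_hom_surjective[OF lie_algebra_operad_der alg_der_eq_unary])
    (auto simp: operad_der_def alg_der_def unary_bracket fun_eq_iff unary_def)

definition split_derivation :: "(nat \<Rightarrow> 'a \<Rightarrow> 'a) \<Rightarrow> 'k \<times> ('a \<Rightarrow> 'a)" where
  "split_derivation D = (weight D, unary D)"

lemma weight_linear:
  assumes "operad_derivation P D" "operad_derivation P E"
  shows "weight (\<lambda>n x. D n x + E n x) = weight D + weight E"
    and "weight (\<lambda>n x. scal P c (D n x)) = c * weight D"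
  using assms operad_derivationD(2) u0_closed by (simp_all add: weight_def coord_add coord_scale)

text \<open>Both components are Lie homomorphisms, the weight because commutators act by \<open>0\<close> on a line.
  Hence the semidirect product is even a direct product.\<close>

lemma split_derivation_iso:
  "lie_isomorphic (operad_der P) (lie_semidirect lie_line (\<lambda>_ _. 0) (alg_der aug))"
proof -
  have surj: "lcarrier (lie_semidirect lie_line (\<lambda>_ _. 0) (alg_der aug))
      = split_derivation ` lcarrier (operad_der P)"
  proof (intro equalityI subsetI)
    fix y :: "'k \<times> ('a \<Rightarrow> 'a)"
    assume "y \<in> lcarrier (lie_semidirect lie_line (\<lambda>_ _. 0) (alg_der aug))"
    then obtain c d where y: "y = (c, d)" and d: "alg_derivation aug d"
      by (auto simp: lie_semidirect_def alg_der_def)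
    show "y \<in> split_derivation ` lcarrier (operad_der P)"
      using operad_derivation_extend[OF d, of c] weight_extend[OF d, of c] unary_extend[OF d, of c]
      by (intro image_eqI[of _ _ "extend c d"]) (simp_all add: y split_derivation_def operad_der_def)
  qed (auto simp: split_derivation_def lie_semidirect_def lie_line_def operad_der_def alg_der_def
      alg_derivation_unary)
  have "lie_hom (operad_der P) (lie_semidirect lie_line (\<lambda>_ _. 0) (alg_der aug)) split_derivation"
  proof (rule lie_hom_surjective[OF lie_algebra_operad_der surj], goal_cases)
    case 1
    then show ?case
      using coord_scale_u0[of 0]
      by (simp add: split_derivation_def lie_semidirect_def lie_line_def operad_der_def alg_der_def
          weight_def unary_def fun_eq_iff)
  next
    case (2 D E)
    then show ?case
      by (auto simp: split_derivation_def lie_semidirect_def lie_line_def operad_der_def alg_der_def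
          weight_linear unary_def fun_eq_iff)
  next
    case (3 c D)
    then show ?case
      by (auto simp: split_derivation_def lie_semidirect_def lie_line_def operad_der_def alg_der_def
          weight_linear unary_def fun_eq_iff)
  next
    case (4 D E)
    then show ?case
      by (simp add: split_derivation_def lie_semidirect_def lie_line_def operad_der_def alg_der_def
          weight_bracket unary_bracket)
  qed
  moreover have "inj_on split_derivation (lcarrier (operad_der P))"
    by (auto simp: inj_on_def split_derivation_def operad_der_def intro: derivation_eqI)
  ultimately show ?thesis
    unfolding lie_isomorphic_def bij_betw_def using surj by blast
qed

lemma alg_derivation_zero: "alg_derivation aug (\<lambda>x. 0)"
  using lie_algebra.zero_closed[OF lie_algebra_alg_der] by (simp add: alg_der_def)

text \<open>The kernel of the restriction consists of the derivations \<open>extend c 0\<close>, which scale arity \<open>n\<close> by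
  \<open>c * (1 - n)\<close>.\<close>

lemma derivations_exact:
  "lie_short_exact lie_line (\<lambda>c. extend c (\<lambda>x. 0)) (operad_der P) unary (alg_der aug)"
proof -
  note Z = alg_derivation_zero
  have euler: "extend c (\<lambda>x. 0) n \<theta> = (if \<theta> \<in> arity P n then scal P (c * (1 - of_nat n)) \<theta> else 0)" for c n \<theta>
    by (simp add: extend_def ext_der_def comp_zero_right unit_of_closed del: One_nat_def)
  have "lie_hom lie_line (operad_der P) (\<lambda>c. extend c (\<lambda>x. 0))"
  proof (intro lie_hom.intro lie_hom_axioms.intro lie_algebra_line lie_algebra_operad_der)
    fix c b :: 'k
    show "extend c (\<lambda>x. 0) \<in> lcarrier (operad_der P)"
      using operad_derivation_extend[OF Z] by (simp add: operad_der_def)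
    show "extend (ladd lie_line c b) (\<lambda>x. 0) = ladd (operad_der P) (extend c (\<lambda>x. 0)) (extend b (\<lambda>x. 0))"
      by (auto simp: lie_line_def operad_der_def fun_eq_iff euler distrib_right vs.scale_left_distrib)
    show "extend (lsmult lie_line c b) (\<lambda>x. 0) = lsmult (operad_der P) c (extend b (\<lambda>x. 0))"
      by (auto simp: lie_line_def operad_der_def fun_eq_iff euler mult.assoc)
    show "extend (lbracket lie_line c b) (\<lambda>x. 0)
        = lbracket (operad_der P) (extend c (\<lambda>x. 0)) (extend b (\<lambda>x. 0))"
      by (auto simp: lie_line_def operad_der_def fun_eq_iff euler arity_closed mult_ac)
  qed
  moreover have "inj_on (\<lambda>c. extend c (\<lambda>x. 0)) (lcarrier lie_line)"
    by (rule inj_onI) (metis weight_extend[OF Z])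
  moreover have "(\<lambda>c. extend c (\<lambda>x. 0)) ` lcarrier lie_line
      = {D \<in> lcarrier (operad_der P). unary D = lzero (alg_der aug)}"
  proof (intro equalityI subsetI)
    fix D assume "D \<in> {D \<in> lcarrier (operad_der P). unary D = lzero (alg_der aug)}"
    then have "D = extend (weight D) (\<lambda>x. 0)"
      using derivation_eq_extend[of D] by (simp add: operad_der_def alg_der_def)
    then show "D \<in> (\<lambda>c. extend c (\<lambda>x. 0)) ` lcarrier lie_line"
      unfolding lie_line_def by auto
  qed (auto simp: operad_der_def alg_der_def operad_derivation_extend[OF Z] unary_extend[OF Z])
  ultimately show ?thesis
    unfolding lie_short_exact_def using unary_hom alg_der_eq_unary by blast
qed

lemma trivial_action: "lie_action (alg_der aug) (lie_line :: ('k, 'k) lie_struct) (\<lambda>_ _. 0)"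
  unfolding lie_action_def using lie_algebra_alg_der lie_algebra_line by (simp add: lie_line_def)

text \<open>The inner derivations of the operad are exactly those that restrict to inner derivations of the
  augmentation ideal, so the kernel line disappears in the quotient.\<close>

lemma H1_iso: "lie_isomorphic (operad_H1 P) (HH1 aug)"
  unfolding operad_H1_def HH1_def
  by (rule lie_isomorphic_quotients[OF unary_hom alg_der_eq_unary[symmetric] _ lie_ideal_alg_ider
        operad_ider_iff])
    (simp add: operad_der_def alg_der_def unary_def fun_eq_iff)

end

theorem theorem0p4:
  fixes P :: "('k::field, 'a::ab_group_add) operad_data" and u0 :: 'a
  assumes "two_unitary_operad P u0" and "GKdim P = 2"
  shows "(\<exists>f g. lie_short_exact (lie_line :: ('k, 'k) lie_struct) f
              (operad_der P) g (alg_der (aug_ideal P u0))) \<and>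
         (\<exists>\<phi>. lie_action (alg_der (aug_ideal P u0)) (lie_line :: ('k, 'k) lie_struct) \<phi> \<and>
              lie_isomorphic (operad_der P)
                (lie_semidirect lie_line \<phi> (alg_der (aug_ideal P u0)))) \<and>
         lie_isomorphic (operad_H1 P) (HH1 (aug_ideal P u0))"
proof -
  interpret two_unitary_operad P u0 by (rule assms(1))
  interpret coordinate_operad P u0
    by unfold_locales (rule kill_jointly_injective[OF assms(2)])
  show ?thesis
    using derivations_exact trivial_action split_derivation_iso H1_iso by blast
qed

end
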